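(* Let $\{a_{i,j}\}_{1\le i\le 3,\,1\le j\le 2}$ be real constants and let $\mathcal{M}_A=(\mathbb{R}^{14},g_A)$ be the pseudo-Riemannian manifold defined in the context. Then $\mathcal{M}_A$ has $0$-model $\mathfrak{M}_{14}$. Furthermore, $\mathcal{M}_A$ is locally symmetric (i.e. $\nabla R=0$) if and only if all of the following hold: (1) $a_{1,1}+a_{2,2}+a_{3,1}a_{3,2}=2$. (2) $3a_{2,1}+3a_{3,1}+3a_{1,2}a_{1,1}=4$. (3) $3a_{1,2}+3a_{3,2}+3a_{2,1}a_{2,2}=4$.
   Context: Conventions: $\mathcal{R}(X,Y)=\nabla_X\nabla_Y-\nabla_Y\nabla_X-\nabla_{[X,Y]}$ and $R(X,Y,Z,W)=g(\mathcal{R}(X,Y)Z,W)$, where $\nabla$ is the Levi-Civita connection. The metric $g_A$: let $\{x_i,x_i^*,y_{i,1},y_{i,2},y_{4,1},y_{4,2}\}$, $1\le i\le3$, be coordinates on $\mathbb{R}^{14}$. The non-zero components of $g_A$ are, up to symmetry: $g_A(\partial_{x_i},\partial_{x_i^*})=g_A(\partial_{y_{i,1}},\partial_{y_{i,2}})=1$ for $1\le i\le3$; $g_A(\partial_{y_{4,1}},\partial_{y_{4,1}})=g_A(\partial_{y_{4,2}},\partial_{y_{4,2}})=-\frac12$, $g_A(\partial_{y_{4,1}},\partial_{y_{4,2}})=\frac14$; $g_A(\partial_{x_1},\partial_{x_1})=-2a_{2,1}x_2y_{2,1}-2a_{3,1}x_3y_{3,1}$; $g_A(\partial_{x_2},\partial_{x_2})=-2a_{3,2}x_3y_{3,2}-2a_{1,2}x_1y_{1,2}$;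 $g_A(\partial_{x_3},\partial_{x_3})=-2a_{1,1}x_1y_{1,1}-2a_{2,2}x_2y_{2,2}$; $g_A(\partial_{x_1},\partial_{x_2})=2(1-a_{2,1})x_1y_{2,1}+2(1-a_{1,2})x_2y_{1,2}$; $g_A(\partial_{x_2},\partial_{x_3})=x_1y_{4,1}+2(1-a_{3,2})x_2y_{3,2}+2(1-a_{2,2})x_3y_{2,2}$; $g_A(\partial_{x_1},\partial_{x_3})=x_2y_{4,2}+2(1-a_{3,1})x_1y_{3,1}+2(1-a_{1,1})x_3y_{1,1}$. The model $\mathfrak{M}_{14}=(\mathbb{R}^{14},\langle\cdot,\cdot\rangle,A)$: $\mathbb{R}^{14}$ has basis $\{\alpha_i,\alpha_i^*,\beta_{i,1},\beta_{i,2},\beta_{4,1},\beta_{4,2}\}$, $1\le i\le 3$, and the non-zero components of the symmetric inner product $\langle\cdot,\cdot\rangle$ and of the algebraic curvature tensor $A$ (a $4$-tensor with the symmetries of the Riemann curvature tensor; not to be confused with the index $A$ of $g_A$) are, up to the usual symmetries: $\langle\alpha_i,\alpha_i^*\rangle=\langle\beta_{i,1},\beta_{i,2}\rangle=1$ for $1\le i\le3$; $\langle\beta_{4,1},\beta_{4,1}\rangle=\langle\beta_{4,2},\beta_{4,2}\rangle=-\frac12$; $\langle\beta_{4,1},\beta_{4,2}\rangle=\frac14$; $A(\alpha_2,\alpha_1,\alpha_1,\beta_{2,1})=A(\alpha_3,\alpha_1,\alpha_1,\beta_{3,1})=1$; $A(\alpha_3,\alpha_2,\alpha_2,\beta_{3,2})=A(\alpha_1,\alpha_2,\alpha_2,\beta_{1,2})=1$;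 $A(\alpha_1,\alpha_3,\alpha_3,\beta_{1,1})=A(\alpha_2,\alpha_3,\alpha_3,\beta_{2,2})=1$; $A(\alpha_1,\alpha_2,\alpha_3,\beta_{4,1})=A(\alpha_1,\alpha_3,\alpha_2,\beta_{4,1})=-\frac12$; $A(\alpha_2,\alpha_3,\alpha_1,\beta_{4,2})=A(\alpha_2,\alpha_1,\alpha_3,\beta_{4,2})=-\frac12$. A pseudo-Riemannian manifold $(M,g)$ has $0$-model $\mathfrak{M}_{14}$ if for every $P\in M$ there is a linear isomorphism $\Theta_P:T_PM\to\mathbb{R}^{14}$ with $\Theta_P^*\langle\cdot,\cdot\rangle=g_P$ and $\Theta_P^*A=R_P$. *)

theory Defs
  imports "HOL-Analysis.Analysis"
begin

section \<open>Smooth maps\<close>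

fun Ck :: "nat \<Rightarrow> ('a::real_normed_vector \<Rightarrow> 'b::real_normed_vector) \<Rightarrow> bool" where
  "Ck 0 f \<longleftrightarrow> continuous_on UNIV f"
| "Ck (Suc k) f \<longleftrightarrow>
     (\<forall>p. f differentiable at p) \<and> (\<forall>v. Ck k (\<lambda>p. frechet_derivative f (at p) v))"

text \<open>On a finite-dimensional domain (the only use below) this is the usual notion of a
  \<open>C\<^sup>\<infinity>\<close> map.\<close>

definition smooth :: "('a::real_normed_vector \<Rightarrow> 'b::real_normed_vector) \<Rightarrow> bool" where
  "smooth f \<longleftrightarrow> (\<forall>k. Ck k f)"


section \<open>Pseudo-Riemannian geometry on \<open>\<real>\<^sup>n\<close> in its global chart\<close>

text \<open>A metric is a field of matrices \<open>g p $ i $ j = g\<^sub>p(\<partial>\<^sub>i, \<partial>\<^sub>j)\<close>; every tangent space is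
  identified with \<^typ>\<open>real^'n\<close> through the coordinate frame, and a vector field is a map
  \<^typ>\<open>real^'n \<Rightarrow> real^'n\<close>.\<close>

type_synonym 'n vfield = "real^'n \<Rightarrow> real^'n"
type_synonym 'n metric = "real^'n \<Rightarrow> real^'n^'n"

definition form :: "real^'n^'n \<Rightarrow> real^'n \<Rightarrow> real^'n \<Rightarrow> real" where
  "form M u v = u \<bullet> (M *v v)"

definition pseudo_riemannian :: "'n::finite metric \<Rightarrow> bool" where
  "pseudo_riemannian g \<longleftrightarrow>
     smooth g \<and> (\<forall>p. transpose (g p) = g p) \<and>
     (\<forall>p u. (\<forall>v. form (g p) u v = 0) \<longrightarrow> u = 0)"

definition dir_deriv :: "'n::finite vfield \<Rightarrow> (real^'n \<Rightarrow> 'b::real_normed_vector) \<Rightarrow> real^'n \<Rightarrow> 'b"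
  where "dir_deriv X f p = frechet_derivative f (at p) (X p)"

definition lie_bracket :: "'n::finite vfield \<Rightarrow> 'n vfield \<Rightarrow> 'n vfield" where
  "lie_bracket X Y p = dir_deriv X Y p - dir_deriv Y X p"

definition partial :: "'n::finite \<Rightarrow> (real^'n \<Rightarrow> real) \<Rightarrow> real^'n \<Rightarrow> real" where
  "partial i f p = frechet_derivative f (at p) (axis i 1)"

text \<open>\<open>christoffel g p k i j\<close> is \<open>\<Gamma>\<^sup>k\<^sub>i\<^sub>j\<close> at \<open>p\<close>.\<close>

definition christoffel :: "'n::finite metric \<Rightarrow> real^'n \<Rightarrow> 'n \<Rightarrow> 'n \<Rightarrow> 'n \<Rightarrow> real" where
  "christoffel g p k i j =
     (\<Sum>l\<in>UNIV. matrix_inv (g p) $ k $ l *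
        (partial i (\<lambda>q. g q $ j $ l) p + partial j (\<lambda>q. g q $ i $ l) p
         - partial l (\<lambda>q. g q $ i $ j) p)) / 2"

text \<open>The Levi-Civita connection, in coordinates. The lemmas \<open>levi_civita_connection\<close> and
  \<open>levi_civita_unique\<close> below characterise it by the usual axioms.\<close>

definition nabla :: "'n::finite metric \<Rightarrow> 'n vfield \<Rightarrow> 'n vfield \<Rightarrow> 'n vfield" where
  "nabla g X Y p =
     dir_deriv X Y p +
     (\<chi> k. \<Sum>i\<in>UNIV. \<Sum>j\<in>UNIV. christoffel g p k i j * X p $ i * Y p $ j)"

definition curv_op :: "'n::finite metric \<Rightarrow> 'n vfield \<Rightarrow> 'n vfield \<Rightarrow> 'n vfield \<Rightarrow> 'n vfield" where
  "curv_op g X Y Z p =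
     nabla g X (nabla g Y Z) p - nabla g Y (nabla g X Z) p - nabla g (lie_bracket X Y) Z p"

definition curv ::
    "'n::finite metric \<Rightarrow> 'n vfield \<Rightarrow> 'n vfield \<Rightarrow> 'n vfield \<Rightarrow> 'n vfield \<Rightarrow> real^'n \<Rightarrow> real" where
  "curv g X Y Z W p = form (g p) (curv_op g X Y Z p) (W p)"

text \<open>\<open>nabla_curv g V X Y Z W\<close> is the function \<open>(\<nabla>\<^sub>V R)(X, Y, Z, W)\<close>.\<close>

definition nabla_curv ::
    "'n::finite metric \<Rightarrow> 'n vfield \<Rightarrow> 'n vfield \<Rightarrow> 'n vfield \<Rightarrow> 'n vfield \<Rightarrow> 'n vfield \<Rightarrow>
     real^'n \<Rightarrow> real" where
  "nabla_curv g V X Y Z W p =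
     dir_deriv V (curv g X Y Z W) p
     - curv g (nabla g V X) Y Z W p - curv g X (nabla g V Y) Z W p
     - curv g X Y (nabla g V Z) W p - curv g X Y Z (nabla g V W) p"

definition locally_symmetric :: "'n::finite metric \<Rightarrow> bool" where
  "locally_symmetric g \<longleftrightarrow>
     (\<forall>V X Y Z W. smooth V \<and> smooth X \<and> smooth Y \<and> smooth Z \<and> smooth W \<longrightarrow>
        (\<forall>p. nabla_curv g V X Y Z W p = 0))"

text \<open>A model is a pair of an inner product \<open>ip\<close> and a 4-tensor \<open>A\<close> on the vector space
  \<^typ>\<open>real^'m\<close>. The tensor \<open>R\<^sub>P\<close> is evaluated on tangent vectors by evaluating \<open>R\<close> on
  arbitrary smooth vector fields extending them.\<close>

definition has_0_model ::
    "'n::finite metric \<Rightarrow> (real^'m::finite \<Rightarrow> real^'m \<Rightarrow> real) \<Rightarrow>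
     (real^'m \<Rightarrow> real^'m \<Rightarrow> real^'m \<Rightarrow> real^'m \<Rightarrow> real) \<Rightarrow> bool" where
  "has_0_model g ip A \<longleftrightarrow>
     (\<forall>p. \<exists>\<Theta> :: real^'n \<Rightarrow> real^'m. linear \<Theta> \<and> bij \<Theta> \<and>
        (\<forall>u v. ip (\<Theta> u) (\<Theta> v) = form (g p) u v) \<and>
        (\<forall>X Y Z W. smooth X \<and> smooth Y \<and> smooth Z \<and> smooth W \<longrightarrow>
           A (\<Theta> (X p)) (\<Theta> (Y p)) (\<Theta> (Z p)) (\<Theta> (W p)) = curv g X Y Z W p))"


section \<open>The metrics \<open>g\<^sub>A\<close> and the model on \<open>\<real>\<^sup>1\<^sup>4\<close>\<close>

text \<open>The fourteen indices: \<open>Ix i\<close>, \<open>Ixs i\<close>, \<open>Iy i j\<close> stand for \<open>x\<^sub>i\<close>, \<open>x\<^sub>i\<^sup>*\<close>, \<open>y\<^sub>i\<^sub>,\<^sub>j\<close>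
  as coordinates on the manifold and for \<open>\<alpha>\<^sub>i\<close>, \<open>\<alpha>\<^sub>i\<^sup>*\<close>, \<open>\<beta>\<^sub>i\<^sub>,\<^sub>j\<close> as basis vectors of the model.
  In the numeral types \<^typ>\<open>3\<close>, \<^typ>\<open>4\<close>, \<^typ>\<open>2\<close> the largest numeral is another name for 0, so that
  1, 2, 3 (resp. 1, 2, 3, 4 and 1, 2) are exactly the elements, without repetition.\<close>

datatype idx14 = Ix 3 | Ixs 3 | Iy 4 2

lemma UNIV_idx14:
  "(UNIV :: idx14 set) = range Ix \<union> range Ixs \<union> (\<lambda>(i, j). Iy i j) ` UNIV"
proof (rule set_eqI)
  fix c :: idx14
  show "c \<in> UNIV \<longleftrightarrow> c \<in> range Ix \<union> range Ixs \<union> (\<lambda>(i, j). Iy i j) ` UNIV"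
    by (cases c) (auto intro: rev_image_eqI[of "(_, _)"])
qed

instance idx14 :: finite
  by standard (simp add: UNIV_idx14)

lemma CARD_idx14: "CARD(idx14) = 14"
proof -
  have "card (range Ix \<union> range Ixs \<union> (\<lambda>(i, j). Iy i j) ` UNIV) = 3 + 3 + 4 * 2"
  proof (subst card_Un_disjoint)
    have "card (range Ix \<union> range Ixs) = 3 + 3"
      by (subst card_Un_disjoint) (auto simp: card_image inj_def)
    moreover have "card ((\<lambda>(i, j). Iy i j) ` UNIV) = CARD(4 \<times> 2)"
      by (rule card_image) (auto simp: inj_on_def)
    ultimately show "card (range Ix \<union> range Ixs) + card ((\<lambda>(i, j). Iy i j) ` UNIV) = 3 + 3 + 4 * 2"
      by simp
  qed auto
  then show ?thesis
    by (simp add: UNIV_idx14)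
qed

text \<open>Components are looked up by the unordered pair \<open>{c, d}\<close>, which makes the matrices
  symmetric; \<open>{c, d} = {e}\<close> selects a diagonal entry.\<close>

definition ip14_matrix :: "real^idx14^idx14" where
  "ip14_matrix = (\<chi> c d.
     if \<exists>i. {c, d} = {Ix i, Ixs i} then 1
     else if \<exists>i. i \<noteq> 4 \<and> {c, d} = {Iy i 1, Iy i 2} then 1
     else if {c, d} = {Iy 4 1} \<or> {c, d} = {Iy 4 2} then - 1/2
     else if {c, d} = {Iy 4 1, Iy 4 2} then 1/4
     else 0)"

text \<open>The constant components of \<open>g\<^sub>A\<close> are those of the inner product of the model.\<close>

definition gA :: "(3 \<Rightarrow> 2 \<Rightarrow> real) \<Rightarrow> idx14 metric" where
  "gA a p =
    (let x = (\<lambda>i. p $ Ix i); y = (\<lambda>i j. p $ Iy i j)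
     in \<chi> c d.
       if {c, d} = {Ix 1} then - 2 * a 2 1 * x 2 * y 2 1 - 2 * a 3 1 * x 3 * y 3 1
       else if {c, d} = {Ix 2} then - 2 * a 3 2 * x 3 * y 3 2 - 2 * a 1 2 * x 1 * y 1 2
       else if {c, d} = {Ix 3} then - 2 * a 1 1 * x 1 * y 1 1 - 2 * a 2 2 * x 2 * y 2 2
       else if {c, d} = {Ix 1, Ix 2} then
         2 * (1 - a 2 1) * x 1 * y 2 1 + 2 * (1 - a 1 2) * x 2 * y 1 2
       else if {c, d} = {Ix 2, Ix 3} then
         x 1 * y 4 1 + 2 * (1 - a 3 2) * x 2 * y 3 2 + 2 * (1 - a 2 2) * x 3 * y 2 2
       else if {c, d} = {Ix 1, Ix 3} then
         x 2 * y 4 2 + 2 * (1 - a 3 1) * x 1 * y 3 1 + 2 * (1 - a 1 1) * x 3 * y 1 1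
       else ip14_matrix $ c $ d)"

definition ip14 :: "real^idx14 \<Rightarrow> real^idx14 \<Rightarrow> real" where
  "ip14 = form ip14_matrix"

definition A14_gen :: "idx14 \<Rightarrow> idx14 \<Rightarrow> idx14 \<Rightarrow> idx14 \<Rightarrow> real" where
  "A14_gen b c d e =
     (if (b, c, d, e) \<in>
         {(Ix 2, Ix 1, Ix 1, Iy 2 1), (Ix 3, Ix 1, Ix 1, Iy 3 1),
          (Ix 3, Ix 2, Ix 2, Iy 3 2), (Ix 1, Ix 2, Ix 2, Iy 1 2),
          (Ix 1, Ix 3, Ix 3, Iy 1 1), (Ix 2, Ix 3, Ix 3, Iy 2 2)} then 1
      else if (b, c, d, e) \<in>
         {(Ix 1, Ix 2, Ix 3, Iy 4 1), (Ix 1, Ix 3, Ix 2, Iy 4 1),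
          (Ix 2, Ix 3, Ix 1, Iy 4 2), (Ix 2, Ix 1, Ix 3, Iy 4 2)} then - 1/2
      else 0)"

text \<open>The sum runs over the group of order 8 generated by the usual symmetries. It acts freely on
  each orbit met by \<^const>\<open>A14_gen\<close>, and no two listed components lie in the same orbit, so that the
  listed values are preserved; see \<open>A14_comp_values\<close>.\<close>

definition A14_comp :: "idx14 \<Rightarrow> idx14 \<Rightarrow> idx14 \<Rightarrow> idx14 \<Rightarrow> real" where
  "A14_comp b c d e =
     A14_gen b c d e - A14_gen c b d e - A14_gen b c e d + A14_gen c b e d +
     A14_gen d e b c - A14_gen e d b c - A14_gen d e c b + A14_gen e d c b"

definition A14 :: "real^idx14 \<Rightarrow> real^idx14 \<Rightarrow> real^idx14 \<Rightarrow> real^idx14 \<Rightarrow> real" where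
  "A14 u v w z =
     (\<Sum>b\<in>UNIV. \<Sum>c\<in>UNIV. \<Sum>d\<in>UNIV. \<Sum>e\<in>UNIV.
        A14_comp b c d e * u $ b * v $ c * w $ d * z $ e)"


section \<open>Consistency of the definitions\<close>

lemma A14_comp_values:
  "A14_comp (Ix 2) (Ix 1) (Ix 1) (Iy 2 1) = 1" "A14_comp (Ix 3) (Ix 1) (Ix 1) (Iy 3 1) = 1"
  "A14_comp (Ix 3) (Ix 2) (Ix 2) (Iy 3 2) = 1" "A14_comp (Ix 1) (Ix 2) (Ix 2) (Iy 1 2) = 1"
  "A14_comp (Ix 1) (Ix 3) (Ix 3) (Iy 1 1) = 1" "A14_comp (Ix 2) (Ix 3) (Ix 3) (Iy 2 2) = 1"
  "A14_comp (Ix 1) (Ix 2) (Ix 3) (Iy 4 1) = - 1/2" "A14_comp (Ix 1) (Ix 3) (Ix 2) (Iy 4 1) = - 1/2"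
  "A14_comp (Ix 2) (Ix 3) (Ix 1) (Iy 4 2) = - 1/2" "A14_comp (Ix 2) (Ix 1) (Ix 3) (Iy 4 2) = - 1/2"
  by (simp_all add: A14_comp_def A14_gen_def)

lemma A14_comp_symmetries:
  "A14_comp c b d e = - A14_comp b c d e"
  "A14_comp b c e d = - A14_comp b c d e"
  "A14_comp d e b c = A14_comp b c d e"
  by (simp_all add: A14_comp_def)

lemma A14_gen_eq_0:
  "A14_gen (Ixs i) c d e = 0" "A14_gen (Iy j k) c d e = 0"
  "A14_gen b (Ixs i) d e = 0" "A14_gen b (Iy j k) d e = 0"
  "A14_gen b c (Ixs i) e = 0" "A14_gen b c (Iy j k) e = 0"
  "A14_gen b c d (Ixs i) = 0" "A14_gen b c d (Ix i) = 0"
  by (simp_all add: A14_gen_def)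

lemma A14_gen_bianchi:
  "A14_gen (Ix i) (Ix j) (Ix k) (Iy l m) - A14_gen (Ix j) (Ix i) (Ix k) (Iy l m) +
   (A14_gen (Ix j) (Ix k) (Ix i) (Iy l m) - A14_gen (Ix k) (Ix j) (Ix i) (Iy l m)) +
   (A14_gen (Ix k) (Ix i) (Ix j) (Iy l m) - A14_gen (Ix i) (Ix k) (Ix j) (Iy l m)) = 0"
  using exhaust_3[of i] exhaust_3[of j] exhaust_3[of k]
  by (elim disjE) (simp_all add: A14_gen_def)


lemma A14_comp_bianchi: "A14_comp b c d e + A14_comp c d b e + A14_comp d b c e = 0"
  apply (cases b; cases c; cases d; cases e; simp add: A14_comp_def A14_gen_eq_0)
  subgoal for i j k l m using A14_gen_bianchi[of i j k l m] by linarith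
  subgoal for i j l m k using A14_gen_bianchi[of i j k l m] by linarith
  subgoal for i l m j k using A14_gen_bianchi[of i j k l m] by linarith
  subgoal for l m i j k using A14_gen_bianchi[of i j k l m] by linarith
  done

lemma Ck_Suc_imp_Ck: "Ck (Suc k) f \<Longrightarrow> Ck k f"
proof (induction k arbitrary: f)
  case 0
  then show ?case
    by (auto simp: continuous_on_eq_continuous_within intro: differentiable_imp_continuous_within)
qed auto

lemma Ck_const: "Ck k (\<lambda>p. c)"
  by (induction k arbitrary: c) auto

lemma Ck_bounded_linear:
  assumes "bounded_linear h"
  shows "Ck k f \<Longrightarrow> Ck k (\<lambda>p. h (f p))"
proof (induction k arbitrary: f)
  case 0
  then show ?case
    by (simp add: assms bounded_linear.continuous_on)
next
  case (Suc k)
  have D: "((\<lambda>p. h (f p)) has_derivative (\<lambda>v. h (frechet_derivative f (at p) v))) (at p)" for p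
    using Suc.prems by (intro bounded_linear.has_derivative[OF assms])
      (simp add: frechet_derivative_works[symmetric])
  show ?case
    using Suc D by (auto simp: frechet_derivative_at[OF D, symmetric] differentiable_def)
qed

lemma Ck_add: "Ck k f \<Longrightarrow> Ck k f' \<Longrightarrow> Ck k (\<lambda>p. f p + f' p)"
proof (induction k arbitrary: f f')
  case 0
  then show ?case by (simp add: continuous_on_add)
next
  case (Suc k)
  have D: "((\<lambda>p. f p + f' p) has_derivative
      (\<lambda>v. frechet_derivative f (at p) v + frechet_derivative f' (at p) v)) (at p)" for p
    using Suc.prems by (intro has_derivative_add) (simp_all add: frechet_derivative_works[symmetric])
  show ?case
    using Suc D by (auto simp: frechet_derivative_at[OF D, symmetric] differentiable_def)
qed

lemma Ck_bounded_bilinear: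
  assumes "bounded_bilinear h"
  shows "Ck k f \<Longrightarrow> Ck k f' \<Longrightarrow> Ck k (\<lambda>p. h (f p) (f' p))"
proof (induction k arbitrary: f f')
  case 0
  then show ?case
    by (simp add: assms bounded_bilinear.continuous_on)
next
  case (Suc k)
  have D: "((\<lambda>p. h (f p) (f' p)) has_derivative
      (\<lambda>v. h (f p) (frechet_derivative f' (at p) v) + h (frechet_derivative f (at p) v) (f' p))) (at p)" for p
    using Suc.prems by (intro bounded_bilinear.FDERIV[OF assms])
      (simp_all add: frechet_derivative_works[symmetric])
  have "Ck k f" "Ck k f'"
    using Suc.prems Ck_Suc_imp_Ck by blast+
  then show ?case
    using Suc D by (auto simp: frechet_derivative_at[OF D, symmetric] differentiable_def
        intro!: Ck_add Suc.IH)
qed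

lemma smooth_const: "smooth (\<lambda>p. c)"
  by (simp add: smooth_def Ck_const)

lemma smooth_bounded_linear: "bounded_linear h \<Longrightarrow> smooth f \<Longrightarrow> smooth (\<lambda>p. h (f p))"
  by (simp add: smooth_def Ck_bounded_linear)

lemma smooth_add: "smooth f \<Longrightarrow> smooth f' \<Longrightarrow> smooth (\<lambda>p. f p + f' p)"
  by (simp add: smooth_def Ck_add)

lemma smooth_bounded_bilinear:
  "bounded_bilinear h \<Longrightarrow> smooth f \<Longrightarrow> smooth f' \<Longrightarrow> smooth (\<lambda>p. h (f p) (f' p))"
  by (simp add: smooth_def Ck_bounded_bilinear)

lemma smooth_mult: "smooth f \<Longrightarrow> smooth f' \<Longrightarrow> smooth (\<lambda>p. f p * f' p :: real)"
  by (rule smooth_bounded_bilinear[OF bounded_bilinear_mult])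

lemma smooth_diff: "smooth f \<Longrightarrow> smooth f' \<Longrightarrow> smooth (\<lambda>p. f p - f' p)"
  using smooth_add[of f "\<lambda>p. - f' p"] smooth_bounded_linear[OF bounded_linear_minus[OF bounded_linear_ident], of f']
  by simp

lemma smooth_ident: "smooth (\<lambda>p. p)"
proof -
  have "Ck k (\<lambda>p::'a. p)" for k
    by (cases k) (auto simp: Ck_const)
  then show ?thesis by (simp add: smooth_def)
qed

lemma smooth_sum: "(\<And>i. i \<in> S \<Longrightarrow> smooth (f i)) \<Longrightarrow> smooth (\<lambda>p. \<Sum>i\<in>S. f i p)"
  by (induction S rule: infinite_finite_induct) (auto simp: smooth_const intro: smooth_add)

lemma smooth_vec:
  fixes f :: "'a::real_normed_vector \<Rightarrow> 'b::euclidean_space^'n"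
  assumes "\<And>i. smooth (\<lambda>p. f p $ i)"
  shows "smooth f"
proof -
  have "f = (\<lambda>p. \<Sum>i\<in>UNIV. axis i (f p $ i))"
    by (auto simp: fun_eq_iff vec_eq_iff axis_def)
  have "bounded_linear (axis i :: 'b \<Rightarrow> 'b^'n)" for i
    unfolding linear_conv_bounded_linear[symmetric]
    by (auto simp: linear_iff axis_def vec_eq_iff)
  then have "smooth (\<lambda>p. \<Sum>i\<in>UNIV. axis i (f p $ i))"
    by (auto intro!: smooth_sum smooth_bounded_linear[OF _ assms])
  then show ?thesis
    using \<open>f = _\<close> by simp
qed

lemma smooth_imp_differentiable: "smooth f \<Longrightarrow> f differentiable at p"
  by (metis Ck.simps(2) smooth_def)

lemma smooth_if: "smooth f \<Longrightarrow> smooth f' \<Longrightarrow> smooth (\<lambda>p. if P then f p else f' p)"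
  by (cases P) simp_all

lemma smooth_nth: "smooth (\<lambda>p::real^'n. p $ i)"
  by (rule smooth_bounded_linear[OF bounded_linear_vec_nth smooth_ident])

lemma smooth_gA: "smooth (gA a)"
  by (intro smooth_vec, unfold gA_def Let_def vec_lambda_beta)
    (intro smooth_if smooth_add smooth_diff smooth_mult smooth_nth smooth_const)

lemma gA_symmetric: "transpose (gA a p) = gA a p"
proof -
  have "gA a p $ c $ d = gA a p $ d $ c" for c d
    by (simp only: gA_def ip14_matrix_def Let_def vec_lambda_beta insert_commute[of c d])
  then show ?thesis
    by (simp add: transpose_def vec_eq_iff)
qed

lemma form_sum: "form M u v = (\<Sum>i\<in>UNIV. \<Sum>j\<in>UNIV. M $ i $ j * u $ i * v $ j)"
  by (simp add: form_def inner_vec_def matrix_vector_mult_def sum_distrib_left mult_ac)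

lemma gA_eq_ip14:
  "gA a p $ c $ Ixs i = ip14_matrix $ c $ Ixs i" "gA a p $ Ixs i $ c = ip14_matrix $ Ixs i $ c"
  "gA a p $ c $ Iy k j = ip14_matrix $ c $ Iy k j" "gA a p $ Iy k j $ c = ip14_matrix $ Iy k j $ c"
  by (simp_all add: gA_def Let_def doubleton_eq_iff)

lemma ip14_matrix_simps:
  "ip14_matrix $ c $ Ixs i = (if c = Ix i then 1 else 0)"
  "k \<noteq> 4 \<Longrightarrow> ip14_matrix $ c $ Iy k 1 = (if c = Iy k 2 then 1 else 0)"
  "k \<noteq> 4 \<Longrightarrow> ip14_matrix $ c $ Iy k 2 = (if c = Iy k 1 then 1 else 0)"
  "ip14_matrix $ c $ Iy 4 1 = (if c = Iy 4 1 then - 1/2 else if c = Iy 4 2 then 1/4 else 0)"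
  "ip14_matrix $ c $ Iy 4 2 = (if c = Iy 4 2 then - 1/2 else if c = Iy 4 1 then 1/4 else 0)"
  "ip14_matrix $ Ixs j $ Ix i = (if j = i then 1 else 0)"
  by (auto simp: ip14_matrix_def doubleton_eq_iff)

lemma gA_nondegenerate:
  assumes "\<And>v. form (gA a p) u v = 0"
  shows "u = 0"
proof -
  have row: "(\<Sum>c\<in>UNIV. gA a p $ c $ d * u $ c) = 0" for d
  proof -
    have "(\<Sum>c\<in>UNIV. gA a p $ c $ d * u $ c) = form (gA a p) u (axis d 1)"
      by (simp add: form_def matrix_vector_mult_basis column_def inner_vec_def mult.commute)
    then show ?thesis
      using assms by simp
  qed
  have delta: "(\<Sum>c\<in>UNIV. (if c = e then r else 0) * u $ c) = r * u $ e" for e r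
    by (simp add: if_distrib[where f = "\<lambda>x. x * _"] cong: if_cong)
  have delta2: "(\<Sum>c\<in>UNIV. (if c = e then r else if c = e' then r' else 0) * u $ c) =
      r * u $ e + r' * u $ e'" if "e \<noteq> e'" for e e' r r'
  proof -
    have "(\<Sum>c\<in>UNIV. (if c = e then r else if c = e' then r' else 0) * u $ c) =
        (\<Sum>c\<in>UNIV. (if c = e then r else 0) * u $ c + (if c = e' then r' else 0) * u $ c)"
      using that by (intro sum.cong) auto
    then show ?thesis
      by (simp only: sum.distrib delta)
  qed
  have X: "u $ Ix i = 0" for i
    using row[of "Ixs i"] delta[of "Ix i" 1] by (simp add: gA_eq_ip14 ip14_matrix_simps)
  have Y: "u $ Iy k j = 0" for k j
  proof (cases "k = 4")
    case False
    then show ?thesis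
      using row[of "Iy k 1"] row[of "Iy k 2"] delta[of "Iy k 1" 1] delta[of "Iy k 2" 1] exhaust_2[of j]
      by (auto simp: gA_eq_ip14 ip14_matrix_simps)
  next
    case True
    have "- 1/2 * u $ Iy 4 1 + 1/4 * u $ Iy 4 2 = 0"
      using row[of "Iy 4 1"] delta2[of "Iy 4 1" "Iy 4 2" "- 1/2" "1/4"]
      unfolding gA_eq_ip14 ip14_matrix_simps by simp
    moreover have "- 1/2 * u $ Iy 4 2 + 1/4 * u $ Iy 4 1 = 0"
      using row[of "Iy 4 2"] delta2[of "Iy 4 2" "Iy 4 1" "- 1/2" "1/4"]
      unfolding gA_eq_ip14 ip14_matrix_simps by simp
    ultimately show ?thesis
      using True exhaust_2[of j] by auto
  qed
  have Z: "u $ Ixs i = 0" for i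
  proof -
    have "gA a p $ c $ Ix i * u $ c = (if c = Ixs i then 1 else 0) * u $ c" for c
      by (cases c) (simp_all add: X Y gA_eq_ip14 ip14_matrix_simps)
    then have "(\<Sum>c\<in>UNIV. gA a p $ c $ Ix i * u $ c) = u $ Ixs i"
      using delta[of "Ixs i" 1] by (simp only: mult_1)
    then show ?thesis
      using row by simp
  qed
  have "u $ c = 0" for c
    by (cases c) (simp_all add: X Y Z)
  then show ?thesis
    by (simp add: vec_eq_iff)
qed

lemma pseudo_riemannian_gA: "pseudo_riemannian (gA a)"
  unfolding pseudo_riemannian_def
  using smooth_gA gA_symmetric gA_nondegenerate by metis

text \<open>The axioms of the Levi-Civita connection of \<open>g\<close>.\<close>

definition levi_civita :: "'n::finite metric \<Rightarrow> ('n vfield \<Rightarrow> 'n vfield \<Rightarrow> 'n vfield) \<Rightarrow> bool" where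
  "levi_civita g D \<longleftrightarrow>
     (\<forall>X X' Y Y' Z f p.
        smooth X \<and> smooth X' \<and> smooth Y \<and> smooth Y' \<and> smooth Z \<and> smooth (f :: real^'n \<Rightarrow> real) \<longrightarrow>
        D (\<lambda>q. X q + X' q) Y p = D X Y p + D X' Y p \<and>
        D (\<lambda>q. f q *\<^sub>R X q) Y p = f p *\<^sub>R D X Y p \<and>
        D X (\<lambda>q. Y q + Y' q) p = D X Y p + D X Y' p \<and>
        D X (\<lambda>q. f q *\<^sub>R Y q) p = dir_deriv X f p *\<^sub>R Y p + f p *\<^sub>R D X Y p \<and>
        D X Y p - D Y X p = lie_bracket X Y p \<and>
        dir_deriv X (\<lambda>q. form (g q) (Y q) (Z q)) p =
          form (g p) (D X Y p) (Z p) + form (g p) (Y p) (D X Z p))"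

lemma form_simps:
  "form M (u + u') v = form M u v + form M u' v" "form M u (v + v') = form M u v + form M u v'"
  "form M (u - u') v = form M u v - form M u' v" "form M u (v - v') = form M u v - form M u v'"
  by (simp_all add: form_def inner_add_left inner_add_right inner_diff_left inner_diff_right
      matrix_vector_right_distrib matrix_vector_mult_diff_distrib)

lemma form_commute: "transpose M = M \<Longrightarrow> form M u v = form M v u"
  by (metis dot_lmul_matrix form_def inner_commute transpose_matrix_vector)

lemma dir_deriv_form:
  fixes g :: "'n::finite metric" and X Y Z :: "'n vfield"
  assumes "g differentiable at p" "Y differentiable at p" "Z differentiable at p"
  shows "dir_deriv X (\<lambda>q. form (g q) (Y q) (Z q)) p =
    form (g p) (dir_deriv X Y p) (Z p) + form (g p) (Y p) (dir_deriv X Z p) +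
    form (dir_deriv X g p) (Y p) (Z p)"
proof -
  have B: "bounded_bilinear (\<lambda>(A::real^'n^'n) v. A *v v)"
    unfolding bilinear_conv_bounded_bilinear[symmetric] bilinear_def
    by (auto simp: linear_iff algebra_simps scaleR_matrix_vector_assoc
        matrix_vector_mult_scaleR)
  have "((\<lambda>q. form (g q) (Y q) (Z q)) has_derivative
     (\<lambda>v. Y p \<bullet> (g p *v frechet_derivative Z (at p) v + frechet_derivative g (at p) v *v Z p) +
          frechet_derivative Y (at p) v \<bullet> (g p *v Z p))) (at p)"
    unfolding form_def
    using has_derivative_inner[OF assms(2)[unfolded frechet_derivative_works]
        bounded_bilinear.FDERIV[OF B assms(1)[unfolded frechet_derivative_works]
          assms(3)[unfolded frechet_derivative_works]]] by simp
  from frechet_derivative_at[OF this, symmetric] show ?thesis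
    by (simp add: dir_deriv_def form_def inner_add_right)
qed

lemma frechet_partial:
  assumes "g differentiable at p"
  shows "frechet_derivative g (at p) u $ i $ j = (\<Sum>l\<in>UNIV. u $ l * partial l (\<lambda>q. g q $ i $ j) p)"
proof -
  have D: "((\<lambda>q. g q $ i $ j) has_derivative (\<lambda>v. frechet_derivative g (at p) v $ i $ j)) (at p)"
    using assms unfolding frechet_derivative_works
    by (intro bounded_linear.has_derivative[OF bounded_linear_vec_nth]) auto
  have lin: "linear (\<lambda>v. frechet_derivative g (at p) v $ i $ j)"
    using D has_derivative_linear by blast
  have "frechet_derivative g (at p) u $ i $ j =
      frechet_derivative g (at p) (\<Sum>l\<in>UNIV. u $ l *\<^sub>R axis l 1) $ i $ j"
    using basis_expansion[of u] by (simp add: scalar_mult_eq_scaleR)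
  also have "\<dots> = (\<Sum>l\<in>UNIV. u $ l * frechet_derivative g (at p) (axis l 1) $ i $ j)"
    by (simp add: linear_sum[OF lin] linear_scale[OF lin])
  also have "\<dots> = (\<Sum>l\<in>UNIV. u $ l * partial l (\<lambda>q. g q $ i $ j) p)"
    by (simp add: partial_def frechet_derivative_at[OF D, symmetric])
  finally show ?thesis .
qed

definition gamma :: "'n::finite metric \<Rightarrow> real^'n \<Rightarrow> real^'n \<Rightarrow> real^'n \<Rightarrow> real^'n" where
  "gamma g p u v = (\<chi> k. \<Sum>i\<in>UNIV. \<Sum>j\<in>UNIV. christoffel g p k i j * u $ i * v $ j)"

lemma form_gamma:
  fixes g :: "'n::finite metric"
  assumes g: "pseudo_riemannian g"
  shows "2 * form (g p) (gamma g p u v) w =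
     form (frechet_derivative g (at p) u) v w + form (frechet_derivative g (at p) v) u w
     - form (frechet_derivative g (at p) w) u v"
proof -
  have gd: "g differentiable at p" and sym: "transpose (g p) = g p"
    using g by (auto simp: pseudo_riemannian_def intro: smooth_imp_differentiable)
  have "inj ((*v) (g p))"
  proof -
    have "x = 0" if "g p *v x = 0" for x
      using g that form_commute[OF sym] unfolding pseudo_riemannian_def form_def
      by (metis inner_zero_right)
    then show ?thesis
      using matrix_left_invertible_injective[of "g p"] matrix_left_invertible_ker[of "g p"] by blast
  qed
  then have inv: "g p ** matrix_inv (g p) = mat 1"
  proof -
    have "\<exists>B. g p ** B = mat 1 \<and> B ** g p = mat 1"
      using \<open>inj _\<close> matrix_left_invertible_injective matrix_left_right_inverse by metis
    then show ?thesis
      unfolding matrix_inv_def by (rule someI2_ex) simp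
  qed
  define c where "c = (\<chi> l. (\<Sum>i\<in>UNIV. \<Sum>j\<in>UNIV.
     (partial i (\<lambda>q. g q $ j $ l) p + partial j (\<lambda>q. g q $ i $ l) p
         - partial l (\<lambda>q. g q $ i $ j) p) * u $ i * v $ j) / 2)"
  have "gamma g p u v = matrix_inv (g p) *v c"
  proof -
    have "(\<Sum>i\<in>UNIV. \<Sum>j\<in>UNIV. (\<Sum>l\<in>UNIV. m l * f i j l) / 2 * u $ i * v $ j) =
        (\<Sum>l\<in>UNIV. m l * ((\<Sum>i\<in>UNIV. \<Sum>j\<in>UNIV. f i j l * u $ i * v $ j) / 2))"
      for m :: "'n \<Rightarrow> real" and f
    proof -
      have "(\<Sum>i\<in>UNIV. \<Sum>j\<in>UNIV. (\<Sum>l\<in>UNIV. m l * f i j l) / 2 * u $ i * v $ j) =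
         (\<Sum>i\<in>UNIV. \<Sum>j\<in>UNIV. \<Sum>l\<in>UNIV. m l * (f i j l * u $ i * v $ j) / 2)"
        by (simp add: sum_distrib_left sum_distrib_right sum_divide_distrib mult_ac)
      also have "\<dots> = (\<Sum>i\<in>UNIV. \<Sum>l\<in>UNIV. \<Sum>j\<in>UNIV. m l * (f i j l * u $ i * v $ j) / 2)"
        by (intro sum.cong refl sum.swap)
      also have "\<dots> = (\<Sum>l\<in>UNIV. \<Sum>i\<in>UNIV. \<Sum>j\<in>UNIV. m l * (f i j l * u $ i * v $ j) / 2)"
        by (rule sum.swap)
      finally show ?thesis
        by (simp add: sum_distrib_left sum_divide_distrib)
    qed
    then show ?thesis
      by (simp add: gamma_def christoffel_def c_def matrix_vector_mult_def vec_eq_iff)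
  qed
  then have "g p *v gamma g p u v = c"
    by (simp add: matrix_vector_mul_assoc inv)
  then have "form (g p) (gamma g p u v) w = c \<bullet> w"
    by (metis form_commute[OF sym] form_def inner_commute)
  also have "2 * (c \<bullet> w) = (\<Sum>l\<in>UNIV. \<Sum>i\<in>UNIV. \<Sum>j\<in>UNIV.
     (partial i (\<lambda>q. g q $ j $ l) p + partial j (\<lambda>q. g q $ i $ l) p
         - partial l (\<lambda>q. g q $ i $ j) p) * u $ i * v $ j * w $ l)"
    by (simp add: c_def inner_vec_def sum_distrib_left sum_distrib_right sum_divide_distrib)
  also have "\<dots> = (\<Sum>l\<in>UNIV. \<Sum>i\<in>UNIV. \<Sum>j\<in>UNIV. partial i (\<lambda>q. g q $ j $ l) p * u $ i * v $ j * w $ l)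
     + (\<Sum>l\<in>UNIV. \<Sum>i\<in>UNIV. \<Sum>j\<in>UNIV. partial j (\<lambda>q. g q $ i $ l) p * u $ i * v $ j * w $ l)
     - (\<Sum>l\<in>UNIV. \<Sum>i\<in>UNIV. \<Sum>j\<in>UNIV. partial l (\<lambda>q. g q $ i $ j) p * u $ i * v $ j * w $ l)"
    by (simp add: algebra_simps sum.distrib sum_subtractf)
  also have "(\<Sum>l\<in>UNIV. \<Sum>i\<in>UNIV. \<Sum>j\<in>UNIV. partial i (\<lambda>q. g q $ j $ l) p * u $ i * v $ j * w $ l) =
      form (frechet_derivative g (at p) u) v w"
  proof -
    have "form (frechet_derivative g (at p) u) v w =
        (\<Sum>j\<in>UNIV. \<Sum>l\<in>UNIV. \<Sum>i\<in>UNIV. partial i (\<lambda>q. g q $ j $ l) p * u $ i * v $ j * w $ l)"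
      by (simp add: form_sum frechet_partial[OF gd] sum_distrib_left sum_distrib_right mult_ac)
    also have "\<dots> = (\<Sum>l\<in>UNIV. \<Sum>j\<in>UNIV. \<Sum>i\<in>UNIV. partial i (\<lambda>q. g q $ j $ l) p * u $ i * v $ j * w $ l)"
      by (rule sum.swap)
    also have "\<dots> = (\<Sum>l\<in>UNIV. \<Sum>i\<in>UNIV. \<Sum>j\<in>UNIV. partial i (\<lambda>q. g q $ j $ l) p * u $ i * v $ j * w $ l)"
      by (intro sum.cong refl sum.swap)
    finally show ?thesis ..
  qed
  also have "(\<Sum>l\<in>UNIV. \<Sum>i\<in>UNIV. \<Sum>j\<in>UNIV. partial j (\<lambda>q. g q $ i $ l) p * u $ i * v $ j * w $ l) =
      form (frechet_derivative g (at p) v) u w"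
  proof -
    have "form (frechet_derivative g (at p) v) u w =
        (\<Sum>i\<in>UNIV. \<Sum>l\<in>UNIV. \<Sum>j\<in>UNIV. partial j (\<lambda>q. g q $ i $ l) p * u $ i * v $ j * w $ l)"
      by (simp add: form_sum frechet_partial[OF gd] sum_distrib_left sum_distrib_right mult_ac)
    also have "\<dots> = (\<Sum>l\<in>UNIV. \<Sum>i\<in>UNIV. \<Sum>j\<in>UNIV. partial j (\<lambda>q. g q $ i $ l) p * u $ i * v $ j * w $ l)"
      by (rule sum.swap)
    finally show ?thesis ..
  qed
  also have "(\<Sum>l\<in>UNIV. \<Sum>i\<in>UNIV. \<Sum>j\<in>UNIV. partial l (\<lambda>q. g q $ i $ j) p * u $ i * v $ j * w $ l) =
      form (frechet_derivative g (at p) w) u v"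
  proof -
    have "form (frechet_derivative g (at p) w) u v =
        (\<Sum>i\<in>UNIV. \<Sum>j\<in>UNIV. \<Sum>l\<in>UNIV. partial l (\<lambda>q. g q $ i $ j) p * u $ i * v $ j * w $ l)"
      by (simp add: form_sum frechet_partial[OF gd] sum_distrib_left sum_distrib_right mult_ac)
    also have "\<dots> = (\<Sum>i\<in>UNIV. \<Sum>l\<in>UNIV. \<Sum>j\<in>UNIV. partial l (\<lambda>q. g q $ i $ j) p * u $ i * v $ j * w $ l)"
      by (intro sum.cong refl sum.swap)
    also have "\<dots> = (\<Sum>l\<in>UNIV. \<Sum>i\<in>UNIV. \<Sum>j\<in>UNIV. partial l (\<lambda>q. g q $ i $ j) p * u $ i * v $ j * w $ l)"
      by (rule sum.swap)
    finally show ?thesis ..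
  qed
  finally show ?thesis .
qed

lemma gamma_linear:
  "gamma g p (u + u') v = gamma g p u v + gamma g p u' v"
  "gamma g p u (v + v') = gamma g p u v + gamma g p u v'"
  "gamma g p (r *\<^sub>R u) v = r *\<^sub>R gamma g p u v"
  "gamma g p u (r *\<^sub>R v) = r *\<^sub>R gamma g p u v"
  by (simp_all add: gamma_def vec_eq_iff sum.distrib sum_distrib_left algebra_simps)

lemma nondegenerate_eqI:
  assumes "pseudo_riemannian g" "\<And>w. form (g p) u w = form (g p) v w"
  shows "u = v"
proof -
  have "form (g p) (u - v) w = 0" for w
    by (simp add: form_simps assms(2))
  then show ?thesis
    using assms(1) unfolding pseudo_riemannian_def by (metis eq_iff_diff_eq_0)
qed

theorem levi_civita_connection:
  fixes g :: "'n::finite metric"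
  assumes g: "pseudo_riemannian g"
  shows "levi_civita g (nabla g)"
  unfolding levi_civita_def
proof (intro allI impI)
  fix X X' Y Y' Z :: "'n vfield" and f :: "real^'n \<Rightarrow> real" and p
  assume "smooth X \<and> smooth X' \<and> smooth Y \<and> smooth Y' \<and> smooth Z \<and> smooth f"
  then have dif: "X differentiable at p" "X' differentiable at p" "Y differentiable at p"
      "Y' differentiable at p" "Z differentiable at p" "f differentiable at p"
    by (auto intro: smooth_imp_differentiable)
  have nabla: "nabla g V W q = dir_deriv V W q + gamma g q (V q) (W q)" for V W q
    by (simp add: nabla_def gamma_def)
  have gd: "g differentiable at p" and sym: "transpose (g p) = g p"
    using g by (auto simp: pseudo_riemannian_def intro: smooth_imp_differentiable)
  have symD: "form (frechet_derivative g (at p) u) v w = form (frechet_derivative g (at p) u) w v"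
    for u v w
  proof (rule form_commute)
    have "g q $ i $ j = g q $ j $ i" for q i j
      using g unfolding pseudo_riemannian_def transpose_def by (metis vec_lambda_beta)
    then show "transpose (frechet_derivative g (at p) u) = frechet_derivative g (at p) u"
      by (simp add: transpose_def vec_eq_iff frechet_partial[OF gd])
  qed
  have gamma_sym: "gamma g p u v = gamma g p v u" for u v
  proof (rule nondegenerate_eqI[OF g])
    fix w
    show "form (g p) (gamma g p u v) w = form (g p) (gamma g p v u) w"
      using form_gamma[OF g, of p u v w] form_gamma[OF g, of p v u w] symD[of w u v] by linarith
  qed
  have lin: "linear (frechet_derivative W (at p))" if "W differentiable at p" for W :: "'n vfield"
    using that by (rule linear_frechet_derivative)
  have 1: "nabla g (\<lambda>q. X q + X' q) Y p = nabla g X Y p + nabla g X' Y p"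
    by (simp add: nabla dir_deriv_def gamma_linear linear_add[OF lin] dif)
  have 2: "nabla g (\<lambda>q. f q *\<^sub>R X q) Y p = f p *\<^sub>R nabla g X Y p"
    by (simp add: nabla dir_deriv_def gamma_linear linear_scale[OF lin] dif algebra_simps)
  have 3: "nabla g X (\<lambda>q. Y q + Y' q) p = nabla g X Y p + nabla g X Y' p"
  proof -
    have "((\<lambda>q. Y q + Y' q) has_derivative
        (\<lambda>v. frechet_derivative Y (at p) v + frechet_derivative Y' (at p) v)) (at p)"
      using dif unfolding frechet_derivative_works by (intro has_derivative_add)
    from frechet_derivative_at[OF this, symmetric] show ?thesis
      by (simp add: nabla dir_deriv_def gamma_linear)
  qed
  have 4: "nabla g X (\<lambda>q. f q *\<^sub>R Y q) p = dir_deriv X f p *\<^sub>R Y p + f p *\<^sub>R nabla g X Y p"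
  proof -
    have "((\<lambda>q. f q *\<^sub>R Y q) has_derivative
        (\<lambda>v. f p *\<^sub>R frechet_derivative Y (at p) v + frechet_derivative f (at p) v *\<^sub>R Y p)) (at p)"
      using dif unfolding frechet_derivative_works by (intro has_derivative_scaleR)
    from frechet_derivative_at[OF this, symmetric] show ?thesis
      by (simp add: nabla dir_deriv_def gamma_linear algebra_simps)
  qed
  have 5: "nabla g X Y p - nabla g Y X p = lie_bracket X Y p"
    using gamma_sym[of "X p" "Y p"] by (simp add: nabla lie_bracket_def)
  have 6: "dir_deriv X (\<lambda>q. form (g q) (Y q) (Z q)) p =
      form (g p) (nabla g X Y p) (Z p) + form (g p) (Y p) (nabla g X Z p)"
  proof -
    have "form (dir_deriv X g p) (Y p) (Z p) =
        form (g p) (gamma g p (X p) (Y p)) (Z p) + form (g p) (gamma g p (X p) (Z p)) (Y p)"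
      using form_gamma[OF g, of p "X p" "Y p" "Z p"] form_gamma[OF g, of p "X p" "Z p" "Y p"]
        symD[of "X p" "Y p" "Z p"] symD[of "Y p" "X p" "Z p"] symD[of "Z p" "X p" "Y p"]
      unfolding dir_deriv_def by linarith
    then show ?thesis
      using form_commute[OF sym]
      by (simp add: dir_deriv_form gd dif nabla form_simps)
  qed
  from 1 2 3 4 5 6 show
    "nabla g (\<lambda>q. X q + X' q) Y p = nabla g X Y p + nabla g X' Y p \<and>
     nabla g (\<lambda>q. f q *\<^sub>R X q) Y p = f p *\<^sub>R nabla g X Y p \<and>
     nabla g X (\<lambda>q. Y q + Y' q) p = nabla g X Y p + nabla g X Y' p \<and>
     nabla g X (\<lambda>q. f q *\<^sub>R Y q) p = dir_deriv X f p *\<^sub>R Y p + f p *\<^sub>R nabla g X Y p \<and>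
     nabla g X Y p - nabla g Y X p = lie_bracket X Y p \<and>
     dir_deriv X (\<lambda>q. form (g q) (Y q) (Z q)) p =
       form (g p) (nabla g X Y p) (Z p) + form (g p) (Y p) (nabla g X Z p)"
    by blast
qed

theorem levi_civita_unique:
  fixes g :: "'n::finite metric"
  assumes g: "pseudo_riemannian g"
    and D: "levi_civita g D" and D': "levi_civita g D'"
    and XY: "smooth X" "smooth Y"
  shows "D X Y p = D' X Y p"
proof (rule nondegenerate_eqI[OF g])
  fix w :: "real^'n"
  define Z where "Z = (\<lambda>q::real^'n. w)"
  have Z: "smooth Z"
    by (simp add: Z_def smooth_const)
  have sym: "transpose (g p) = g p"
    using g by (auto simp: pseudo_riemannian_def)
  have koszul: "2 * form (g p) (E X Y p) w =
      dir_deriv X (\<lambda>q. form (g q) (Y q) (Z q)) p + dir_deriv Y (\<lambda>q. form (g q) (X q) (Z q)) p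
      - dir_deriv Z (\<lambda>q. form (g q) (X q) (Y q)) p + form (g p) (lie_bracket X Y p) w
      - form (g p) (lie_bracket X Z p) (Y p) - form (g p) (lie_bracket Y Z p) (X p)"
    if E: "levi_civita g E" for E
  proof -
    have met: "dir_deriv U (\<lambda>q. form (g q) (V q) (W q)) p =
        form (g p) (E U V p) (W p) + form (g p) (V p) (E U W p)"
      if "smooth U" "smooth V" "smooth W" for U V W :: "'n vfield"
      using E that smooth_const[of "0::real"] unfolding levi_civita_def by blast
    have tor: "lie_bracket U V p = E U V p - E V U p" if "smooth U" "smooth V" for U V :: "'n vfield"
      using E that smooth_const[of "0::real"] unfolding levi_civita_def by metis
    have Zp: "Z p = w"
      by (simp add: Z_def)
    show ?thesis
      using form_commute[OF sym, of "X p"] form_commute[OF sym, of "Y p"]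
      by (simp add: met tor XY Z form_simps Zp)
  qed
  show "form (g p) (D X Y p) w = form (g p) (D' X Y p) w"
    using koszul[OF D] koszul[OF D'] by linarith
qed

end

theory Submission
  imports Defs
begin

text \<open>The non-constant part of \<open>g\<^sub>A\<close> is linear in the \<open>x\<close>-coordinates and in the
  \<open>y\<close>-coordinates and involves only the directions \<open>\<partial>\<^bsub>x\<^esub>\<close>. Hence the Christoffel map
  \<open>\<Gamma>\<^sub>p(u, v)\<close> is trilinear in \<open>p, u, v\<close> and has no \<open>x\<close>-component, and the curvature is
  \<open>R\<^sub>p = A + N\<^sub>p\<close>, where \<open>A\<close> is the constant model tensor and
  \<open>N\<^sub>p(u, v, w, z)\<close>, which comes from the products of Christoffel symbols, is quadratic
  in \<open>p\<close> and depends only on the \<open>x\<close>-parts of its arguments, that is, it is a symmetric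
  form in the bivectors \<open>u \<and> v\<close> and \<open>w \<and> z\<close> of \<open>\<real>\<^sup>3\<close>. Moving the \<open>x\<close>-frame by suitable
  \<open>y\<close>-vectors absorbs \<open>N\<^sub>p\<close> into \<open>A\<close>, and a further correction along
  the \<open>x\<^sup>*\<close>-directions, which \<open>A\<close> does not see, restores the inner product. The same
  bookkeeping shows that \<open>\<nabla>R\<close> depends only on \<open>x\<close>-parts and is a form in the two bivectors
  whose coefficients are linear combinations of the three quantities in the
  conditions.\<close>

section \<open>Calculus of smooth maps\<close>

lemma smooth_has_derivative:
  "smooth f \<Longrightarrow> (f has_derivative frechet_derivative f (at p)) (at p)"
  using smooth_imp_differentiable frechet_derivative_works by blast

lemma smooth_frechet_derivative: "smooth f \<Longrightarrow> smooth (\<lambda>p. frechet_derivative f (at p) v)"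
  unfolding smooth_def by (metis Ck.simps(2))

lemma smooth_imp_continuous: "smooth f \<Longrightarrow> isCont f p"
  by (rule differentiable_imp_continuous_within) (rule smooth_imp_differentiable)

lemma frechet_derivative_bounded_linear:
  assumes "bounded_linear h" "smooth f"
  shows "frechet_derivative (\<lambda>q. h (f q)) (at p) v = h (frechet_derivative f (at p) v)"
  using frechet_derivative_at[OF bounded_linear.has_derivative[OF assms(1)
      smooth_has_derivative[OF assms(2)]], symmetric] by simp

lemma smooth_derivative_on_line:
  fixes f :: "'a::real_normed_vector \<Rightarrow> real"
  assumes "smooth f"
  shows "((\<lambda>s. f (c + s *\<^sub>R v)) has_real_derivative
           frechet_derivative f (at (c + s *\<^sub>R v)) v) (at s)"
proof -
  let ?F = "frechet_derivative f (at (c + s *\<^sub>R v))"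
  have "((\<lambda>s. c + s *\<^sub>R v) has_derivative (\<lambda>r. r *\<^sub>R v)) (at s)"
    by (auto intro!: derivative_eq_intros)
  from has_derivative_compose[OF this smooth_has_derivative[OF assms]]
  have "((\<lambda>s. f (c + s *\<^sub>R v)) has_derivative (\<lambda>r. ?F (r *\<^sub>R v))) (at s)" .
  moreover have "linear ?F"
    using smooth_has_derivative[OF assms] has_derivative_linear by blast
  ultimately show ?thesis
    by (simp add: linear_scale has_field_derivative_def mult.commute[of _ "?F v"])
qed

text \<open>The mean value theorem is applied twice: in direction \<open>v\<close> to the difference
  of \<open>f\<close> along two parallel segments, then in direction \<open>w\<close> to the first
  derivative so obtained.\<close>

lemma second_difference_mvt:
  fixes f :: "'a::real_normed_vector \<Rightarrow> real"
  assumes f: "smooth f" and h: "h > 0"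
  shows "\<exists>\<xi> \<eta>. 0 < \<xi> \<and> \<xi> < h \<and> 0 < \<eta> \<and> \<eta> < h \<and>
    f (p + h *\<^sub>R v + h *\<^sub>R w) - f (p + h *\<^sub>R v) - f (p + h *\<^sub>R w) + f p =
    h * h * frechet_derivative (\<lambda>q. frechet_derivative f (at q) v)
       (at (p + \<xi> *\<^sub>R v + \<eta> *\<^sub>R w)) w"
proof -
  let ?D = "\<lambda>q. frechet_derivative f (at q) v"
  have "\<exists>\<xi>. 0 < \<xi> \<and> \<xi> < h \<and>
    (f (p + h *\<^sub>R w + h *\<^sub>R v) - f (p + h *\<^sub>R v)) - (f (p + h *\<^sub>R w + 0 *\<^sub>R v) - f (p + 0 *\<^sub>R v)) =
    (h - 0) * (?D (p + h *\<^sub>R w + \<xi> *\<^sub>R v) - ?D (p + \<xi> *\<^sub>R v))"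
    by (rule MVT2[OF h]) (intro DERIV_diff smooth_derivative_on_line f)
  then obtain \<xi> where \<xi>: "0 < \<xi>" "\<xi> < h" and 1:
    "f (p + h *\<^sub>R v + h *\<^sub>R w) - f (p + h *\<^sub>R v) - f (p + h *\<^sub>R w) + f p =
     h * (?D (p + \<xi> *\<^sub>R v + h *\<^sub>R w) - ?D (p + \<xi> *\<^sub>R v))"
    by (auto simp: add_ac)
  have "\<exists>\<eta>. 0 < \<eta> \<and> \<eta> < h \<and> ?D (p + \<xi> *\<^sub>R v + h *\<^sub>R w) - ?D (p + \<xi> *\<^sub>R v + 0 *\<^sub>R w) =
    (h - 0) * frechet_derivative ?D (at (p + \<xi> *\<^sub>R v + \<eta> *\<^sub>R w)) w"
    by (rule MVT2[OF h]) (intro smooth_derivative_on_line smooth_frechet_derivative f)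
  then obtain \<eta> where "0 < \<eta>" "\<eta> < h" "?D (p + \<xi> *\<^sub>R v + h *\<^sub>R w) - ?D (p + \<xi> *\<^sub>R v) =
    h * frechet_derivative ?D (at (p + \<xi> *\<^sub>R v + \<eta> *\<^sub>R w)) w"
    by auto
  with \<xi> 1 show ?thesis
    by (intro exI[of _ \<xi>] exI[of _ \<eta>]) (simp add: mult.assoc)
qed

lemma second_derivative_symmetric_real:
  fixes f :: "'a::real_normed_vector \<Rightarrow> real"
  assumes f: "smooth f"
  shows "frechet_derivative (\<lambda>q. frechet_derivative f (at q) v) (at p) w =
    frechet_derivative (\<lambda>q. frechet_derivative f (at q) w) (at p) v"
proof -
  \<comment> \<open>\<open>\<Delta>\<close> is unchanged when \<open>v\<close> and \<open>w\<close>
    are exchanged, so the same quotient by \<open>h * h\<close> converges to both mixed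
    derivatives.\<close>
  define \<Delta> where "\<Delta> h = f (p + h *\<^sub>R v + h *\<^sub>R w) - f (p + h *\<^sub>R v) - f (p + h *\<^sub>R w) + f p"
    for h :: real
  define h where "h n = inverse (real (Suc n))" for n
  have h: "h n > 0" for n
    by (simp add: h_def)
  have h0: "h \<longlonglongrightarrow> 0"
    unfolding h_def by (rule LIMSEQ_inverse_real_of_nat)
  have lim: "(\<lambda>n. \<Delta> (h n) / (h n * h n)) \<longlonglongrightarrow> frechet_derivative (\<lambda>q. frechet_derivative f (at q) a) (at p) b"
    if ab: "\<And>h. \<Delta> h = f (p + h *\<^sub>R a + h *\<^sub>R b) - f (p + h *\<^sub>R a) - f (p + h *\<^sub>R b) + f p" for a b
  proof -
    let ?D = "\<lambda>q. frechet_derivative (\<lambda>q. frechet_derivative f (at q) a) (at q) b"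
    have "\<forall>n. \<exists>\<xi> \<eta>. 0 < \<xi> \<and> \<xi> < h n \<and> 0 < \<eta> \<and> \<eta> < h n \<and>
       \<Delta> (h n) = h n * h n * ?D (p + \<xi> *\<^sub>R a + \<eta> *\<^sub>R b)"
      unfolding ab using second_difference_mvt[OF f h] by blast
    then obtain \<xi> \<eta> where \<xi>: "\<And>n. 0 < \<xi> n" "\<And>n. \<xi> n < h n"
        and \<eta>: "\<And>n. 0 < \<eta> n" "\<And>n. \<eta> n < h n"
        and \<Delta>: "\<And>n. \<Delta> (h n) = h n * h n * ?D (p + \<xi> n *\<^sub>R a + \<eta> n *\<^sub>R b)"
      by metis
    have "\<xi> \<longlonglongrightarrow> 0" "\<eta> \<longlonglongrightarrow> 0"
      using \<xi> \<eta> by (auto intro!: tendsto_sandwich[OF _ _ tendsto_const h0] always_eventually less_imp_le)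
    then have "(\<lambda>n. p + \<xi> n *\<^sub>R a + \<eta> n *\<^sub>R b) \<longlonglongrightarrow> p + 0 *\<^sub>R a + 0 *\<^sub>R b"
      by (intro tendsto_intros)
    moreover have "isCont ?D p"
      by (intro smooth_imp_continuous smooth_frechet_derivative f)
    ultimately have "(\<lambda>n. ?D (p + \<xi> n *\<^sub>R a + \<eta> n *\<^sub>R b)) \<longlonglongrightarrow> ?D p"
      by (intro isCont_tendsto_compose[of p ?D]) simp_all
    moreover have "\<Delta> (h n) / (h n * h n) = ?D (p + \<xi> n *\<^sub>R a + \<eta> n *\<^sub>R b)" for n
      using h[of n] by (simp add: \<Delta>)
    ultimately show ?thesis
      by simp
  qed
  show ?thesis
    by (rule LIMSEQ_unique[OF lim lim]) (simp_all add: \<Delta>_def add_ac)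
qed

lemma second_derivative_symmetric:
  fixes f :: "'a::real_normed_vector \<Rightarrow> 'b::euclidean_space"
  assumes f: "smooth f"
  shows "frechet_derivative (\<lambda>q. frechet_derivative f (at q) v) (at p) w =
    frechet_derivative (\<lambda>q. frechet_derivative f (at q) w) (at p) v"
proof (rule euclidean_eqI)
  fix b :: 'b
  have "bounded_linear (\<lambda>x. x \<bullet> b)"
    by (rule bounded_linear_inner_left)
  note D = frechet_derivative_bounded_linear[OF this]
  show "frechet_derivative (\<lambda>q. frechet_derivative f (at q) v) (at p) w \<bullet> b =
      frechet_derivative (\<lambda>q. frechet_derivative f (at q) w) (at p) v \<bullet> b"
    using second_derivative_symmetric_real[OF smooth_bounded_linear[OF bounded_linear_inner_left f]]
    by (simp add: D[symmetric] smooth_frechet_derivative f)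
qed

section \<open>Product rule for trilinear maps\<close>

definition trilinear ::
    "('a::real_vector \<Rightarrow> 'b::real_vector \<Rightarrow> 'c::real_vector \<Rightarrow> 'd::real_vector) \<Rightarrow> bool" where
  "trilinear T \<longleftrightarrow>
     (\<forall>u v. linear (\<lambda>p. T p u v)) \<and> (\<forall>p v. linear (\<lambda>u. T p u v)) \<and> (\<forall>p u. linear (T p u))"

text \<open>With the last argument frozen at a basis vector a trilinear map becomes bilinear, so
  derivatives and smoothness reduce to products and finite sums.\<close>

lemma trilinear_expand:
  fixes T :: "'a::euclidean_space \<Rightarrow> 'b::euclidean_space \<Rightarrow> 'c::euclidean_space \<Rightarrow> 'd::real_normed_vector"
  assumes "trilinear T"
  shows "T p u v = (\<Sum>b\<in>Basis. (v \<bullet> b) *\<^sub>R T p u b)"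
proof -
  have lin: "linear (T p u)"
    using assms by (simp add: trilinear_def)
  have "T p u v = T p u (\<Sum>b\<in>Basis. (v \<bullet> b) *\<^sub>R b)"
    by (simp add: euclidean_representation)
  then show ?thesis
    by (simp add: linear_sum[OF lin] linear_scale[OF lin])
qed

lemma trilinear_bounded_bilinear:
  fixes T :: "'a::euclidean_space \<Rightarrow> 'b::euclidean_space \<Rightarrow> 'c::euclidean_space \<Rightarrow> 'd::real_normed_vector"
  assumes "trilinear T"
  shows "bounded_bilinear (\<lambda>p u. T p u v)"
  using assms by (simp add: bilinear_conv_bounded_bilinear[symmetric] bilinear_def trilinear_def)

lemma has_derivative_trilinear:
  fixes T :: "'a::euclidean_space \<Rightarrow> 'b::euclidean_space \<Rightarrow> 'c::euclidean_space \<Rightarrow> 'd::real_normed_vector"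
  assumes T: "trilinear T"
    and "(P has_derivative P') (at x)" "(X has_derivative X') (at x)" "(Y has_derivative Y') (at x)"
  shows "((\<lambda>q. T (P q) (X q) (Y q)) has_derivative
    (\<lambda>h. T (P' h) (X x) (Y x) + T (P x) (X' h) (Y x) + T (P x) (X x) (Y' h))) (at x)"
proof -
  have "((\<lambda>q. \<Sum>b\<in>Basis. (Y q \<bullet> b) *\<^sub>R T (P q) (X q) b) has_derivative
    (\<lambda>h. \<Sum>b\<in>Basis. (Y x \<bullet> b) *\<^sub>R (T (P x) (X' h) b + T (P' h) (X x) b)
      + (Y' h \<bullet> b) *\<^sub>R T (P x) (X x) b)) (at x)"
    by (intro has_derivative_sum has_derivative_scaleR has_derivative_inner_left assms
        bounded_bilinear.FDERIV[OF trilinear_bounded_bilinear[OF T]])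
  also have "(\<lambda>q. \<Sum>b\<in>Basis. (Y q \<bullet> b) *\<^sub>R T (P q) (X q) b) = (\<lambda>q. T (P q) (X q) (Y q))"
    by (simp add: trilinear_expand[OF T, symmetric])
  also have "(\<lambda>h. \<Sum>b\<in>Basis. (Y x \<bullet> b) *\<^sub>R (T (P x) (X' h) b + T (P' h) (X x) b)
      + (Y' h \<bullet> b) *\<^sub>R T (P x) (X x) b) =
    (\<lambda>h. T (P' h) (X x) (Y x) + T (P x) (X' h) (Y x) + T (P x) (X x) (Y' h))"
    by (simp add: scaleR_add_right sum.distrib trilinear_expand[OF T, symmetric] add_ac)
  finally show ?thesis .
qed

lemma smooth_scaleR: "smooth f \<Longrightarrow> smooth f' \<Longrightarrow> smooth (\<lambda>p. f p *\<^sub>R f' p)"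
  by (rule smooth_bounded_bilinear[OF bounded_bilinear_scaleR])

lemma smooth_trilinear:
  fixes T :: "'a::euclidean_space \<Rightarrow> 'b::euclidean_space \<Rightarrow> 'c::euclidean_space \<Rightarrow> 'd::real_normed_vector"
  assumes T: "trilinear T" and "smooth P" "smooth X" "smooth Y"
  shows "smooth (\<lambda>q. T (P q) (X q) (Y q))"
proof -
  have "smooth (\<lambda>q. \<Sum>b\<in>Basis. (Y q \<bullet> b) *\<^sub>R T (P q) (X q) b)"
    by (intro smooth_sum smooth_scaleR smooth_bounded_linear[OF bounded_linear_inner_left] assms
        smooth_bounded_bilinear[OF trilinear_bounded_bilinear[OF T]])
  then show ?thesis
    by (simp add: trilinear_expand[OF T, symmetric])
qed

section \<open>Iterated directional derivatives\<close>

lemma dir_deriv_expand: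
  assumes "smooth X"
  shows "dir_deriv V X p = (\<Sum>b\<in>Basis. (V p \<bullet> b) *\<^sub>R frechet_derivative X (at p) b)"
proof -
  have lin: "linear (frechet_derivative X (at p))"
    using smooth_has_derivative[OF assms] has_derivative_linear by blast
  have "dir_deriv V X p = frechet_derivative X (at p) (\<Sum>b\<in>Basis. (V p \<bullet> b) *\<^sub>R b)"
    by (simp add: dir_deriv_def euclidean_representation)
  then show ?thesis
    by (simp add: linear_sum[OF lin] linear_scale[OF lin])
qed

lemma smooth_dir_deriv:
  assumes "smooth V" "smooth X"
  shows "smooth (dir_deriv V X)"
proof -
  have "smooth (\<lambda>p. \<Sum>b\<in>Basis. (V p \<bullet> b) *\<^sub>R frechet_derivative X (at p) b)"
    by (intro smooth_sum smooth_scaleR smooth_bounded_linear[OF bounded_linear_inner_left] assms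
        smooth_frechet_derivative)
  then show ?thesis
    using dir_deriv_expand[OF assms(2)] by presburger
qed

text \<open>The product rule separates the first-order term, which becomes a Lie bracket on
  antisymmetrizing, from the Hessian of \<open>X\<close>, which is symmetric and cancels.\<close>

lemma dir_deriv_dir_deriv:
  assumes V: "smooth V" and X: "smooth X"
  shows "dir_deriv W (dir_deriv V X) p =
    frechet_derivative X (at p) (dir_deriv W V p) +
    frechet_derivative (\<lambda>q. frechet_derivative X (at q) (V p)) (at p) (W p)"
proof -
  have lin: "linear (frechet_derivative X (at q))" for q
    using smooth_has_derivative[OF X] has_derivative_linear by blast
  have D: "((\<lambda>q. \<Sum>b\<in>Basis. (Y q \<bullet> b) *\<^sub>R frechet_derivative X (at q) b) has_derivative
    (\<lambda>h. \<Sum>b\<in>Basis. (Y p \<bullet> b) *\<^sub>R frechet_derivative (\<lambda>q. frechet_derivative X (at q) b) (at p) h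
      + (frechet_derivative Y (at p) h \<bullet> b) *\<^sub>R frechet_derivative X (at p) b)) (at p)"
    if "smooth Y" for Y
    by (intro has_derivative_sum has_derivative_scaleR has_derivative_inner_left that X
       smooth_has_derivative smooth_frechet_derivative)
  have 1: "dir_deriv Z (dir_deriv Y X) p =
    (\<Sum>b\<in>Basis. (Y p \<bullet> b) *\<^sub>R frechet_derivative (\<lambda>q. frechet_derivative X (at q) b) (at p) (Z p)) +
    frechet_derivative X (at p) (dir_deriv Z Y p)" if "smooth Y" for Y Z
  proof -
    have "dir_deriv Y X = (\<lambda>q. \<Sum>b\<in>Basis. (Y q \<bullet> b) *\<^sub>R frechet_derivative X (at q) b)"
      using dir_deriv_expand[OF X] by blast
    moreover have "frechet_derivative X (at p) (dir_deriv Z Y p) =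
      (\<Sum>b\<in>Basis. (frechet_derivative Y (at p) (Z p) \<bullet> b) *\<^sub>R frechet_derivative X (at p) b)"
      using dir_deriv_expand[OF X, of "\<lambda>_. dir_deriv Z Y p" p] by (simp add: dir_deriv_def)
    ultimately show ?thesis
      using frechet_derivative_at[OF D[OF that], symmetric]
      by (simp add: dir_deriv_def[of Z] sum.distrib)
  qed
  \<comment> \<open>A second use of \<open>1\<close>, for the constant field with value
    \<open>V p\<close>, has no first-order term and so identifies the sum over the basis with the
    Hessian.\<close>
  have "frechet_derivative X (at p) 0 = 0"
    by (rule linear_0[OF lin])
  moreover have "dir_deriv (\<lambda>_. V p) X = (\<lambda>q. frechet_derivative X (at q) (V p))"
    by (simp add: dir_deriv_def fun_eq_iff)
  ultimately show ?thesis
    using 1[OF V, of W] 1[OF smooth_const, of W "V p"]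
    by (simp add: dir_deriv_def[of W])
qed

section \<open>Curvature of a connection with linear Christoffel symbols\<close>

lemma nabla_eq_gamma: "nabla g X Y p = dir_deriv X Y p + gamma g p (X p) (Y p)"
  by (simp add: nabla_def gamma_def)

text \<open>Linearity in the base point makes the derivative of the Christoffel map in direction
  \<open>h\<close> its value at base point \<open>h\<close>, so the derivative terms of the
  curvature are again values of \<open>\<Gamma>\<close>.\<close>

locale linear_christoffel =
  fixes g :: "'n::finite metric" and \<Gamma> :: "real^'n \<Rightarrow> real^'n \<Rightarrow> real^'n \<Rightarrow> real^'n"
  assumes gamma_eq: "gamma g p u v = \<Gamma> p u v"
    and trilinear: "trilinear \<Gamma>"
begin

lemma nabla_eq: "nabla g X Y = (\<lambda>p. dir_deriv X Y p + \<Gamma> p (X p) (Y p))"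
  by (simp add: fun_eq_iff nabla_eq_gamma gamma_eq)

lemma smooth_nabla: "smooth X \<Longrightarrow> smooth Y \<Longrightarrow> smooth (nabla g X Y)"
  unfolding nabla_eq by (rule smooth_add[OF smooth_dir_deriv smooth_trilinear[OF trilinear smooth_ident]])

lemma linear_add_diff:
  "\<Gamma> p u (v + v') = \<Gamma> p u v + \<Gamma> p u v'" "\<Gamma> p (u + u') v = \<Gamma> p u v + \<Gamma> p u' v"
  "\<Gamma> p (u - u') v = \<Gamma> p u v - \<Gamma> p u' v"
  using trilinear linear_add[of "\<Gamma> p u"] linear_add[of "\<lambda>u. \<Gamma> p u v"] linear_diff[of "\<lambda>u. \<Gamma> p u v"]
  by (auto simp: trilinear_def)

lemma dir_deriv_nabla:
  assumes Y: "smooth Y" and Z: "smooth Z"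
  shows "dir_deriv X (nabla g Y Z) p =
    dir_deriv X (dir_deriv Y Z) p + \<Gamma> (X p) (Y p) (Z p) + \<Gamma> p (dir_deriv X Y p) (Z p) +
    \<Gamma> p (Y p) (dir_deriv X Z p)"
proof -
  have "((\<lambda>p. dir_deriv Y Z p + \<Gamma> p (Y p) (Z p)) has_derivative
     (\<lambda>h. frechet_derivative (dir_deriv Y Z) (at p) h +
       (\<Gamma> h (Y p) (Z p) + \<Gamma> p (frechet_derivative Y (at p) h) (Z p) +
       \<Gamma> p (Y p) (frechet_derivative Z (at p) h)))) (at p)"
    by (intro has_derivative_add has_derivative_trilinear trilinear has_derivative_ident
        smooth_has_derivative smooth_dir_deriv Y Z)
  from frechet_derivative_at[OF this, symmetric] show ?thesis
    by (simp add: nabla_eq dir_deriv_def[of X])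
qed

text \<open>All derivatives of the fields drop out: the Hessian of \<open>Z\<close> is symmetric,
  the mixed terms agree in both orders, and the bracket term removes the first-order ones.\<close>

lemma curv_op_eq:
  assumes X: "smooth X" and Y: "smooth Y" and Z: "smooth Z"
  shows "curv_op g X Y Z p =
    \<Gamma> (X p) (Y p) (Z p) - \<Gamma> (Y p) (X p) (Z p) +
    \<Gamma> p (X p) (\<Gamma> p (Y p) (Z p)) - \<Gamma> p (Y p) (\<Gamma> p (X p) (Z p))"
proof -
  let ?D = "frechet_derivative Z (at p)"
  have lin: "linear ?D"
    using smooth_has_derivative[OF Z] has_derivative_linear by blast
  have nn: "nabla g U (nabla g V Z) p = dir_deriv U (nabla g V Z) p + \<Gamma> p (U p) (nabla g V Z p)"
    for U V
    by (subst nabla_eq) simp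
  have nZ: "nabla g U Z p = ?D (U p) + \<Gamma> p (U p) (Z p)" for U
    by (simp add: nabla_eq dir_deriv_def)
  have DD: "dir_deriv X (dir_deriv Y Z) p = dir_deriv Y (dir_deriv X Z) p + ?D (lie_bracket X Y p)"
    by (simp add: dir_deriv_dir_deriv X Y Z second_derivative_symmetric[OF Z, of "Y p" p "X p"]
        lie_bracket_def linear_diff[OF lin])
  have "nabla g X (nabla g Y Z) p = dir_deriv X (dir_deriv Y Z) p + \<Gamma> (X p) (Y p) (Z p) +
      \<Gamma> p (dir_deriv X Y p) (Z p) + \<Gamma> p (Y p) (?D (X p)) + \<Gamma> p (X p) (?D (Y p)) +
      \<Gamma> p (X p) (\<Gamma> p (Y p) (Z p))" if "smooth Y" for X Y
    by (simp add: nn dir_deriv_nabla[OF that Z] nZ linear_add_diff dir_deriv_def[of X Z])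
  from this[OF Y, of X] this[OF X, of Y] show ?thesis
    by (simp add: curv_op_def nZ DD linear_add_diff lie_bracket_def)
qed

end

section \<open>The metric as a quartic form\<close>

lemma sum_idx14:
  fixes f :: "idx14 \<Rightarrow> 'a::comm_monoid_add"
  shows "(\<Sum>c\<in>UNIV. f c) =
    (\<Sum>i\<in>UNIV. f (Ix i)) + (\<Sum>i\<in>UNIV. f (Ixs i)) + (\<Sum>k\<in>UNIV. \<Sum>j\<in>UNIV. f (Iy k j))"
proof -
  have "(\<Sum>c\<in>UNIV. f c) = (\<Sum>c\<in>range Ix \<union> range Ixs. f c) + (\<Sum>c\<in>(\<lambda>(k, j). Iy k j) ` UNIV. f c)"
    unfolding UNIV_idx14 by (rule sum.union_disjoint) auto
  also have "(\<Sum>c\<in>range Ix \<union> range Ixs. f c) = (\<Sum>c\<in>range Ix. f c) + (\<Sum>c\<in>range Ixs. f c)"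
    by (rule sum.union_disjoint) auto
  also have "(\<Sum>c\<in>range Ix. f c) = (\<Sum>i\<in>UNIV. f (Ix i))"
    by (subst sum.reindex) (auto simp: inj_def)
  also have "(\<Sum>c\<in>range Ixs. f c) = (\<Sum>i\<in>UNIV. f (Ixs i))"
    by (subst sum.reindex) (auto simp: inj_def)
  also have "(\<Sum>c\<in>(\<lambda>(k, j). Iy k j) ` UNIV. f c) = (\<Sum>(k, j)\<in>UNIV \<times> UNIV. f (Iy k j))"
    by (subst sum.reindex) (auto simp: inj_on_def case_prod_unfold)
  finally show ?thesis
    by (simp add: sum.cartesian_product)
qed

lemma axis_nth: "axis i x $ j = (if i = j then x else 0)"
  by (simp add: axis_def)

lemma ip14_eq:
  "ip14 u v =
    u $ Ix 1 * v $ Ixs 1 + u $ Ixs 1 * v $ Ix 1 +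
    u $ Ix 2 * v $ Ixs 2 + u $ Ixs 2 * v $ Ix 2 +
    u $ Ix 3 * v $ Ixs 3 + u $ Ixs 3 * v $ Ix 3 +
    u $ Iy 1 1 * v $ Iy 1 2 + u $ Iy 1 2 * v $ Iy 1 1 +
    u $ Iy 2 1 * v $ Iy 2 2 + u $ Iy 2 2 * v $ Iy 2 1 +
    u $ Iy 3 1 * v $ Iy 3 2 + u $ Iy 3 2 * v $ Iy 3 1 -
    (u $ Iy 4 1 * v $ Iy 4 1 + u $ Iy 4 2 * v $ Iy 4 2) / 2 +
    (u $ Iy 4 1 * v $ Iy 4 2 + u $ Iy 4 2 * v $ Iy 4 1) / 4"
  by (simp add: ip14_def form_sum sum_idx14 sum_2 sum_3 sum_4 ip14_matrix_def doubleton_eq_iff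
      add_divide_distrib)

text \<open>The \<open>x\<close>-coordinates of the base point are taken from \<open>p\<close> and its
  \<open>y\<close>-coordinates from \<open>q\<close>, which makes the non-constant part of the metric linear in
  every argument.\<close>

definition hA :: "(3 \<Rightarrow> 2 \<Rightarrow> real) \<Rightarrow> real^idx14 \<Rightarrow> real^idx14 \<Rightarrow> real^idx14 \<Rightarrow> real^idx14 \<Rightarrow> real"
  where
  "hA a p q u v =
    (let x = (\<lambda>i. p $ Ix i); y = (\<lambda>k j. q $ Iy k j);
         s = (\<lambda>i j. u $ Ix i * v $ Ix j + u $ Ix j * v $ Ix i)
     in - (a 2 1 * x 2 * y 2 1 + a 3 1 * x 3 * y 3 1) * s 1 1
        - (a 3 2 * x 3 * y 3 2 + a 1 2 * x 1 * y 1 2) * s 2 2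
        - (a 1 1 * x 1 * y 1 1 + a 2 2 * x 2 * y 2 2) * s 3 3
        + (2 * (1 - a 2 1) * x 1 * y 2 1 + 2 * (1 - a 1 2) * x 2 * y 1 2) * s 1 2
        + (x 1 * y 4 1 + 2 * (1 - a 3 2) * x 2 * y 3 2 + 2 * (1 - a 2 2) * x 3 * y 2 2) * s 2 3
        + (x 2 * y 4 2 + 2 * (1 - a 3 1) * x 1 * y 3 1 + 2 * (1 - a 1 1) * x 3 * y 1 1) * s 1 3)"

lemma form_gA: "form (gA a p) u v = ip14 u v + hA a p p u v"
proof -
  \<comment> \<open>\<open>D\<close> is the non-constant part of the metric; it lives on the
    x-block, where the constant matrix vanishes.\<close>
  define D where "D c d = gA a p $ c $ d - ip14_matrix $ c $ d" for c d
  have zero: "D c (Ixs i) = 0" "D (Ixs i) c = 0" "D c (Iy k j) = 0" "D (Iy k j) c = 0" for c i k j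
    by (simp_all add: D_def gA_eq_ip14)
  have ip0: "ip14_matrix $ Ix i $ Ix j = 0" for i j
    by (auto simp: ip14_matrix_def doubleton_eq_iff)
  have "form (gA a p) u v = ip14 u v + (\<Sum>c\<in>UNIV. \<Sum>d\<in>UNIV. D c d * u $ c * v $ d)"
    by (simp add: ip14_def form_sum D_def algebra_simps sum.distrib sum_subtractf)
  also have "(\<Sum>c\<in>UNIV. \<Sum>d\<in>UNIV. D c d * u $ c * v $ d) =
      (\<Sum>i\<in>UNIV. \<Sum>j\<in>UNIV. gA a p $ Ix i $ Ix j * u $ Ix i * v $ Ix j)"
    by (simp add: sum_idx14 zero) (simp add: D_def ip0)
  also have "\<dots> = hA a p p u v"
    by (simp add: sum_3 gA_def hA_def Let_def doubleton_eq_iff) (simp add: algebra_simps)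
  finally show ?thesis .
qed

lemma hA_linear:
  "hA a (p + p') q u v = hA a p q u v + hA a p' q u v" "hA a (r *\<^sub>R p) q u v = r * hA a p q u v"
  "hA a p (q + q') u v = hA a p q u v + hA a p q' u v" "hA a p (r *\<^sub>R q) u v = r * hA a p q u v"
  "hA a p q (u + u') v = hA a p q u v + hA a p q u' v" "hA a p q (r *\<^sub>R u) v = r * hA a p q u v"
  "hA a p q u (v + v') = hA a p q u v + hA a p q u v'" "hA a p q u (r *\<^sub>R v) = r * hA a p q u v"
  by (simp_all add: hA_def Let_def algebra_simps)

lemma hA_commute: "hA a p q u v = hA a p q v u"
  by (simp add: hA_def Let_def mult.commute add.commute)

lemma ip14_commute: "ip14 u v = ip14 v u"
  by (simp add: ip14_eq mult.commute)

lemma ip14_linear: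
  "ip14 (u + u') v = ip14 u v + ip14 u' v" "ip14 u (v + v') = ip14 u v + ip14 u v'"
  "ip14 (u - u') v = ip14 u v - ip14 u' v" "ip14 u (v - v') = ip14 u v - ip14 u v'"
  "ip14 (r *\<^sub>R u) v = r * ip14 u v" "ip14 u (r *\<^sub>R v) = r * ip14 u v"
  by (simp_all add: ip14_eq algebra_simps add_divide_distrib diff_divide_distrib)

lemma form_derivative_gA:
  "form (frechet_derivative (gA a) (at p) u) v w = hA a u p v w + hA a p u v w"
proof -
  have "bounded_bilinear (\<lambda>p q. hA a p q v w)"
    unfolding bilinear_conv_bounded_bilinear[symmetric] bilinear_def
    by (auto simp: linear_iff hA_linear)
  from has_derivative_add[OF has_derivative_const[of "ip14 v w"]
      bounded_bilinear.FDERIV[OF this has_derivative_ident has_derivative_ident]]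
  have D: "((\<lambda>q. ip14 v w + hA a q q v w) has_derivative (\<lambda>h. 0 + (hA a p h v w + hA a h p v w))) (at p)" .
  have "dir_deriv (\<lambda>_. u) (\<lambda>q. form (gA a q) v w) p = form (frechet_derivative (gA a) (at p) u) v w"
    using dir_deriv_form[OF smooth_imp_differentiable[OF smooth_gA]
        smooth_imp_differentiable[OF smooth_const[of v]] smooth_imp_differentiable[OF smooth_const[of w]],
        where X = "\<lambda>_. u"]
    by (simp add: dir_deriv_def form_def)
  moreover have "dir_deriv (\<lambda>_. u) (\<lambda>q. form (gA a q) v w) p = hA a p u v w + hA a u p v w"
    by (simp add: dir_deriv_def form_gA frechet_derivative_at[OF D, symmetric])
  ultimately show ?thesis
    by simp
qed

text \<open>The derivative of the metric along \<open>Iy k j\<close>; it depends only on the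
  x-coordinates of the base point.\<close>

definition bA :: "(3 \<Rightarrow> 2 \<Rightarrow> real) \<Rightarrow> 4 \<Rightarrow> 2 \<Rightarrow> real^idx14 \<Rightarrow> real^idx14 \<Rightarrow> real^idx14 \<Rightarrow> real" where
  "bA a k j p u v = hA a p (axis (Iy k j) 1) u v"

text \<open>Twice the Christoffel symbols of the first kind.\<close>

definition kA :: "(3 \<Rightarrow> 2 \<Rightarrow> real) \<Rightarrow> real^idx14 \<Rightarrow> real^idx14 \<Rightarrow> real^idx14 \<Rightarrow> real^idx14 \<Rightarrow> real" where
  "kA a p u v w = hA a u p v w + hA a p u v w + hA a v p u w + hA a p v u w
     - hA a w p u v - hA a p w u v"

text \<open>The \<open>y\<close>-components come from inverting the constant block of the metric:
  \<open>y\<^sub>i\<^sub>,\<^sub>1\<close> and \<open>y\<^sub>i\<^sub>,\<^sub>2\<close> are exchanged for \<open>i \<le> 3\<close>, and the inverse of the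
  block of \<open>y\<^sub>4\<^sub>,\<^sub>1\<close>, \<open>y\<^sub>4\<^sub>,\<^sub>2\<close> has entries \<open>- 8/3\<close> and \<open>- 4/3\<close>.\<close>

definition \<Gamma>A :: "(3 \<Rightarrow> 2 \<Rightarrow> real) \<Rightarrow> real^idx14 \<Rightarrow> real^idx14 \<Rightarrow> real^idx14 \<Rightarrow> real^idx14" where
  "\<Gamma>A a p u v = (\<chi> c. case c of
      Ix i \<Rightarrow> 0
    | Ixs i \<Rightarrow> kA a p u v (axis (Ix i) 1) / 2
    | Iy k j \<Rightarrow> let j' = (if j = 1 then 2 else 1) in
        if k = 4 then 4/3 * bA a 4 j p u v + 2/3 * bA a 4 j' p u v else - bA a k j' p u v / 2)"

lemma \<Gamma>A_x: "\<Gamma>A a p u v $ Ix i = 0"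
  by (simp add: \<Gamma>A_def)

lemma ip14_\<Gamma>A: "ip14 (\<Gamma>A a p u v) w = kA a p u v w / 2"
proof -
  have 1: "kA a p u v w = w $ Ix 1 * kA a p u v (axis (Ix 1) 1) + w $ Ix 2 * kA a p u v (axis (Ix 2) 1) +
      w $ Ix 3 * kA a p u v (axis (Ix 3) 1) - hA a p w u v"
    by (simp add: kA_def hA_def Let_def axis_nth algebra_simps)
  have 2: "hA a p w u v = w $ Iy 1 1 * bA a 1 1 p u v + w $ Iy 1 2 * bA a 1 2 p u v +
      w $ Iy 2 1 * bA a 2 1 p u v + w $ Iy 2 2 * bA a 2 2 p u v +
      w $ Iy 3 1 * bA a 3 1 p u v + w $ Iy 3 2 * bA a 3 2 p u v +
      w $ Iy 4 1 * bA a 4 1 p u v + w $ Iy 4 2 * bA a 4 2 p u v"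
    by (simp add: bA_def hA_def Let_def axis_nth algebra_simps)
  show ?thesis
    unfolding 1 2 ip14_eq \<Gamma>A_def vec_lambda_beta idx14.case Let_def
    by (simp add: algebra_simps add_divide_distrib)
qed

lemma kA_linear:
  "kA a (p + p') u v w = kA a p u v w + kA a p' u v w" "kA a (r *\<^sub>R p) u v w = r * kA a p u v w"
  "kA a p (u + u') v w = kA a p u v w + kA a p u' v w" "kA a p (r *\<^sub>R u) v w = r * kA a p u v w"
  "kA a p u (v + v') w = kA a p u v w + kA a p u v' w" "kA a p u (r *\<^sub>R v) w = r * kA a p u v w"
  by (simp_all add: kA_def hA_linear algebra_simps)

lemma bA_linear:
  "bA a k j (p + p') u v = bA a k j p u v + bA a k j p' u v" "bA a k j (r *\<^sub>R p) u v = r * bA a k j p u v"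
  "bA a k j p (u + u') v = bA a k j p u v + bA a k j p u' v" "bA a k j p (r *\<^sub>R u) v = r * bA a k j p u v"
  "bA a k j p u (v + v') = bA a k j p u v + bA a k j p u v'" "bA a k j p u (r *\<^sub>R v) = r * bA a k j p u v"
  by (simp_all add: bA_def hA_linear)

lemma trilinear_\<Gamma>A: "trilinear (\<Gamma>A a)"
  unfolding trilinear_def linear_iff
  by (auto simp: vec_eq_iff \<Gamma>A_def kA_linear bA_linear Let_def algebra_simps add_divide_distrib
      diff_divide_distrib split: idx14.split)

text \<open>The non-constant part of the metric pairs x-components only. Hence the constant inner
  product can lower the index of any value of \<open>\<Gamma>A\<close>.\<close>

lemma form_gA_\<Gamma>A:
  assumes "\<And>i. u $ Ix i = 0"
  shows "form (gA a p) u v = ip14 u v"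
  using assms by (simp add: form_gA hA_def Let_def)

interpretation gA: linear_christoffel "gA a" "\<Gamma>A a" for a
proof
  show "gamma (gA a) p u v = \<Gamma>A a p u v" for p u v
  proof (rule nondegenerate_eqI[OF pseudo_riemannian_gA])
    show "form (gA a p) (gamma (gA a) p u v) w = form (gA a p) (\<Gamma>A a p u v) w" for w
      using form_gamma[OF pseudo_riemannian_gA, of a p u v w]
      by (simp add: form_gA_\<Gamma>A \<Gamma>A_x ip14_\<Gamma>A form_derivative_gA kA_def)
  qed
qed (rule trilinear_\<Gamma>A)

section \<open>Pointwise curvature and its covariant derivative\<close>

definition RA :: "(3 \<Rightarrow> 2 \<Rightarrow> real) \<Rightarrow> real^idx14 \<Rightarrow> real^idx14 \<Rightarrow> real^idx14 \<Rightarrow> real^idx14 \<Rightarrow> real^idx14 \<Rightarrow> real"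
  where "RA a p u v w z = ip14 (\<Gamma>A a u v w - \<Gamma>A a v u w +
    \<Gamma>A a p u (\<Gamma>A a p v w) - \<Gamma>A a p v (\<Gamma>A a p u w)) z"

lemma curv_gA:
  assumes "smooth X" "smooth Y" "smooth Z"
  shows "curv (gA a) X Y Z W p = RA a p (X p) (Y p) (Z p) (W p)"
  using assms by (simp add: curv_def gA.curv_op_eq RA_def form_gA_\<Gamma>A \<Gamma>A_x)

text \<open>The value of \<open>\<nabla>R\<close> at \<open>p\<close> in direction \<open>t\<close>.
  The first summand differentiates the part of \<open>RA\<close> that is quadratic in the base
  point; the other part is constant.\<close>

definition DRA :: "(3 \<Rightarrow> 2 \<Rightarrow> real) \<Rightarrow> real^idx14 \<Rightarrow> real^idx14 \<Rightarrow> real^idx14 \<Rightarrow> real^idx14 \<Rightarrow> real^idx14 \<Rightarrow>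
    real^idx14 \<Rightarrow> real" where
  "DRA a p t u v w z =
    ip14 (\<Gamma>A a t u (\<Gamma>A a p v w) + \<Gamma>A a p u (\<Gamma>A a t v w)
      - \<Gamma>A a t v (\<Gamma>A a p u w) - \<Gamma>A a p v (\<Gamma>A a t u w)) z
    - RA a p (\<Gamma>A a p t u) v w z - RA a p u (\<Gamma>A a p t v) w z
    - RA a p u v (\<Gamma>A a p t w) z - RA a p u v w (\<Gamma>A a p t z)"

lemma \<Gamma>A_linear:
  "\<Gamma>A a (p + p') u v = \<Gamma>A a p u v + \<Gamma>A a p' u v"
  "\<Gamma>A a p (u + u') v = \<Gamma>A a p u v + \<Gamma>A a p u' v"
  "\<Gamma>A a p u (v + v') = \<Gamma>A a p u v + \<Gamma>A a p u v'"
  using trilinear_\<Gamma>A[of a] unfolding trilinear_def linear_iff by blast+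

text \<open>The derivatives of \<open>X\<close>, \<open>Y\<close>, \<open>Z\<close>,
  \<open>W\<close> enter the directional derivative of the curvature through multilinearity and
  cancel against the same terms of the four \<open>nabla\<close> corrections.\<close>

lemma nabla_curv_gA:
  assumes V: "smooth V" and X: "smooth X" and Y: "smooth Y" and Z: "smooth Z" and W: "smooth W"
  shows "nabla_curv (gA a) V X Y Z W p = DRA a p (V p) (X p) (Y p) (Z p) (W p)"
proof -
  note smooth = V X Y Z W gA.smooth_nabla
  have ip: "bounded_bilinear ip14"
    unfolding bilinear_conv_bounded_bilinear[symmetric] bilinear_def
    by (auto simp: linear_iff ip14_linear)
  note D = has_derivative_trilinear[OF trilinear_\<Gamma>A]
  note DX = smooth_has_derivative[OF X, of p] and DY = smooth_has_derivative[OF Y, of p]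
    and DZ = smooth_has_derivative[OF Z, of p] and DW = smooth_has_derivative[OF W, of p]
  note D1 = has_derivative_diff[OF has_derivative_add[OF has_derivative_diff[OF D[OF DX DY DZ] D[OF DY DX DZ]]
    D[OF has_derivative_ident DX D[OF has_derivative_ident DY DZ]]]
    D[OF has_derivative_ident DY D[OF has_derivative_ident DX DZ]]]
  have "dir_deriv V (curv (gA a) X Y Z W) p =
    dir_deriv V (\<lambda>p. RA a p (X p) (Y p) (Z p) (W p)) p"
    using curv_gA[OF X Y Z] by presburger
  also have "\<dots> =
    ip14 (\<Gamma>A a (V p) (X p) (\<Gamma>A a p (Y p) (Z p)) + \<Gamma>A a p (X p) (\<Gamma>A a (V p) (Y p) (Z p))
      - \<Gamma>A a (V p) (Y p) (\<Gamma>A a p (X p) (Z p)) - \<Gamma>A a p (Y p) (\<Gamma>A a (V p) (X p) (Z p))) (W p)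
    + RA a p (dir_deriv V X p) (Y p) (Z p) (W p) + RA a p (X p) (dir_deriv V Y p) (Z p) (W p)
    + RA a p (X p) (Y p) (dir_deriv V Z p) (W p) + RA a p (X p) (Y p) (Z p) (dir_deriv V W p)"
    unfolding dir_deriv_def RA_def
    by (subst frechet_derivative_at[OF bounded_bilinear.FDERIV[OF ip D1 DW], symmetric])
      (simp add: \<Gamma>A_linear ip14_linear)
  finally show ?thesis
    by (simp add: nabla_curv_def curv_gA smooth)
       (simp add: gA.nabla_eq DRA_def RA_def \<Gamma>A_linear ip14_linear)
qed

lemma locally_symmetric_gA:
  "locally_symmetric (gA a) \<longleftrightarrow> (\<forall>p t u v w z. DRA a p t u v w z = 0)"
proof
  assume *: "locally_symmetric (gA a)"
  show "\<forall>p t u v w z. DRA a p t u v w z = 0"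
  proof (intro allI)
    fix p t u v w z
    show "DRA a p t u v w z = 0"
      using * nabla_curv_gA[of "\<lambda>_. t" "\<lambda>_. u" "\<lambda>_. v" "\<lambda>_. w" "\<lambda>_. z" a p]
      by (simp add: locally_symmetric_def smooth_const)
  qed
next
  show "locally_symmetric (gA a)" if "\<forall>p t u v w z. DRA a p t u v w z = 0"
    using that by (simp add: locally_symmetric_def nabla_curv_gA)
qed

section \<open>The model tensor\<close>

text \<open>The cross product of the x-parts gives the coordinates of the bivector in the basis
  \<open>e2 \<and> e3\<close>, \<open>e3 \<and> e1\<close>, \<open>e1 \<and> e2\<close>.\<close>

definition wedge :: "real^idx14 \<Rightarrow> real^idx14 \<Rightarrow> real^3" where
  "wedge u v = vector
    [u $ Ix 2 * v $ Ix 3 - u $ Ix 3 * v $ Ix 2,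
     u $ Ix 3 * v $ Ix 1 - u $ Ix 1 * v $ Ix 3,
     u $ Ix 1 * v $ Ix 2 - u $ Ix 2 * v $ Ix 1]"

lemma wedge_nth:
  "wedge u v $ 1 = u $ Ix 2 * v $ Ix 3 - u $ Ix 3 * v $ Ix 2"
  "wedge u v $ 2 = u $ Ix 3 * v $ Ix 1 - u $ Ix 1 * v $ Ix 3"
  "wedge u v $ 3 = u $ Ix 1 * v $ Ix 2 - u $ Ix 2 * v $ Ix 1"
  by (simp_all add: wedge_def vector_3)

text \<open>The part of \<open>A(u, v, w, z)\<close> with the \<open>\<beta>\<close>-component in the last slot; it
  depends on \<open>u\<close>, \<open>v\<close> only through \<open>U = u \<and> v\<close>.\<close>

definition \<phi> :: "real^3 \<Rightarrow> real^idx14 \<Rightarrow> real^idx14 \<Rightarrow> real" where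
  "\<phi> U w z =
     w $ Ix 1 * (U $ 2 * z $ Iy 3 1 - U $ 3 * z $ Iy 2 1 - U $ 1 * z $ Iy 4 2 / 2) +
     w $ Ix 2 * (U $ 3 * z $ Iy 1 2 - U $ 1 * z $ Iy 3 2 + U $ 2 * z $ Iy 4 1 / 2) +
     w $ Ix 3 * (U $ 1 * z $ Iy 2 2 - U $ 2 * z $ Iy 1 1 + U $ 3 * (z $ Iy 4 2 - z $ Iy 4 1) / 2)"

text \<open>Turns permutations of indices into permutations of vectors, so that of the eight terms
  of \<open>A14_comp\<close> only \<open>A14_gen\<close> has to be expanded.\<close>

definition contract4 :: "('n \<Rightarrow> 'n \<Rightarrow> 'n \<Rightarrow> 'n \<Rightarrow> real) \<Rightarrow> real^'n::finite \<Rightarrow> real^'n \<Rightarrow> real^'n \<Rightarrow> real^'n \<Rightarrow> real"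
  where "contract4 T u v w z =
    (\<Sum>b\<in>UNIV. \<Sum>c\<in>UNIV. \<Sum>d\<in>UNIV. \<Sum>e\<in>UNIV. T b c d e * u $ b * v $ c * w $ d * z $ e)"

lemma contract4_swap12: "contract4 (\<lambda>b c d e. T c b d e) u v w z = contract4 T v u w z"
  unfolding contract4_def by (rule trans[OF _ sum.swap]) (simp add: mult_ac)

lemma contract4_swap23: "contract4 (\<lambda>b c d e. T b d c e) u v w z = contract4 T u w v z"
  unfolding contract4_def
  by (rule sum.cong[OF refl], rule trans[OF _ sum.swap]) (simp add: mult_ac)

lemma contract4_swap34: "contract4 (\<lambda>b c d e. T b c e d) u v w z = contract4 T u v z w"
  unfolding contract4_def
  by (rule sum.cong[OF refl], rule sum.cong[OF refl], rule trans[OF _ sum.swap]) (simp add: mult_ac)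

lemma contract4_swap_pairs: "contract4 (\<lambda>b c d e. T d e b c) u v w z = contract4 T w z u v"
proof -
  have "contract4 (\<lambda>b c d e. T d e b c) u v w z = contract4 (\<lambda>b c d e. T c e b d) u w v z"
    by (rule contract4_swap23[of "\<lambda>b c d e. T c e b d"])
  also have "\<dots> = contract4 (\<lambda>b c d e. T b e c d) w u v z"
    by (rule contract4_swap12[of "\<lambda>b c d e. T b e c d"])
  also have "\<dots> = contract4 (\<lambda>b c d e. T b d c e) w u z v"
    by (rule contract4_swap34[of "\<lambda>b c d e. T b d c e"])
  also have "\<dots> = contract4 T w z u v"
    by (rule contract4_swap23)
  finally show ?thesis .
qed

lemma contract4_A14_gen:
  "contract4 A14_gen u v w z - contract4 A14_gen v u w z = \<phi> (wedge u v) w z"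
proof -
  have eq: "contract4 A14_gen u v w z =
      u $ Ix 2 * v $ Ix 1 * w $ Ix 1 * z $ Iy 2 1 + u $ Ix 3 * v $ Ix 1 * w $ Ix 1 * z $ Iy 3 1 +
      u $ Ix 3 * v $ Ix 2 * w $ Ix 2 * z $ Iy 3 2 + u $ Ix 1 * v $ Ix 2 * w $ Ix 2 * z $ Iy 1 2 +
      u $ Ix 1 * v $ Ix 3 * w $ Ix 3 * z $ Iy 1 1 + u $ Ix 2 * v $ Ix 3 * w $ Ix 3 * z $ Iy 2 2 -
      u $ Ix 1 * v $ Ix 2 * w $ Ix 3 * z $ Iy 4 1 / 2 - u $ Ix 1 * v $ Ix 3 * w $ Ix 2 * z $ Iy 4 1 / 2 -
      u $ Ix 2 * v $ Ix 3 * w $ Ix 1 * z $ Iy 4 2 / 2 - u $ Ix 2 * v $ Ix 1 * w $ Ix 3 * z $ Iy 4 2 / 2"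
    for u v
  proof -
    have "contract4 A14_gen u v w z =
       (\<Sum>i\<in>UNIV. \<Sum>j\<in>UNIV. \<Sum>k\<in>UNIV. \<Sum>l\<in>UNIV. \<Sum>m\<in>UNIV.
         A14_gen (Ix i) (Ix j) (Ix k) (Iy l m) * u $ Ix i * v $ Ix j * w $ Ix k * z $ Iy l m)"
      by (simp add: contract4_def sum_idx14 A14_gen_eq_0)
    then show ?thesis
      by (simp add: sum_2 sum_3 sum_4 A14_gen_def)
  qed
  show ?thesis
    by (simp add: eq \<phi>_def wedge_nth field_simps)
qed

text \<open>The eight permutations pair up by exchange of the first two arguments of
  \<open>A14_gen\<close>, each pair giving one \<open>\<phi>\<close>.\<close>

lemma A14_eq:
  "A14 u v w z = \<phi> (wedge u v) w z - \<phi> (wedge u v) z w + \<phi> (wedge w z) u v - \<phi> (wedge w z) v u"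
proof -
  let ?c = "\<lambda>T. contract4 T u v w z"
  have "A14 u v w z = ?c (\<lambda>b c d e. A14_gen b c d e) - ?c (\<lambda>b c d e. A14_gen c b d e)
     - ?c (\<lambda>b c d e. A14_gen b c e d) + ?c (\<lambda>b c d e. A14_gen c b e d)
     + ?c (\<lambda>b c d e. A14_gen d e b c) - ?c (\<lambda>b c d e. A14_gen e d b c)
     - ?c (\<lambda>b c d e. A14_gen d e c b) + ?c (\<lambda>b c d e. A14_gen e d c b)"
    unfolding A14_def A14_comp_def contract4_def
    by (simp only: sum.distrib[symmetric] sum_subtractf[symmetric] left_diff_distrib distrib_right)
  also have "?c (\<lambda>b c d e. A14_gen c b d e) = contract4 A14_gen v u w z"
    by (rule contract4_swap12)
  also have "?c (\<lambda>b c d e. A14_gen b c e d) = contract4 A14_gen u v z w"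
    by (rule contract4_swap34)
  also have "?c (\<lambda>b c d e. A14_gen c b e d) = contract4 A14_gen v u z w"
    by (rule trans[OF contract4_swap12[of "\<lambda>b c d e. A14_gen b c e d"] contract4_swap34])
  also have "?c (\<lambda>b c d e. A14_gen d e b c) = contract4 A14_gen w z u v"
    by (rule contract4_swap_pairs)
  also have "?c (\<lambda>b c d e. A14_gen e d b c) = contract4 A14_gen z w u v"
    by (rule trans[OF contract4_swap_pairs[of "\<lambda>b c d e. A14_gen c b d e"] contract4_swap12])
  also have "?c (\<lambda>b c d e. A14_gen d e c b) = contract4 A14_gen w z v u"
    by (rule trans[OF contract4_swap_pairs[of "\<lambda>b c d e. A14_gen b c e d"] contract4_swap34])
  also have "?c (\<lambda>b c d e. A14_gen e d c b) = contract4 A14_gen z w v u"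
    by (rule trans[OF contract4_swap12[of "\<lambda>b c d e. A14_gen e d b c"]
          trans[OF contract4_swap_pairs[of "\<lambda>b c d e. A14_gen c b d e"] contract4_swap12]])
  finally show ?thesis
    by (simp add: contract4_A14_gen[symmetric])
qed

text \<open>In \<open>hA a w q v z\<close> each constant \<open>a i j\<close> multiplies a form
  totally symmetric in the x-parts of \<open>w\<close>, \<open>v\<close>, \<open>z\<close>, so
  antisymmetrizing removes it.\<close>

lemma hA_antisymmetric: "hA a w q v z - hA a z q v w = - 2 * \<phi> (wedge w z) v q"
  unfolding hA_def Let_def \<phi>_def wedge_nth by algebra

text \<open>Half of the left side is the derivative term of the curvature, which is therefore the
  model tensor for every \<open>a\<close>.\<close>

lemma kA_antisymmetric: "kA a u v w z - kA a v u w z = 2 * A14 u v w z"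
  using hA_antisymmetric[of a w u v z] hA_antisymmetric[of a w v u z]
    hA_antisymmetric[of a u w z v] hA_antisymmetric[of a u z w v]
    hA_commute[of a v w u z] hA_commute[of a u w v z] hA_commute[of a u z v w] hA_commute[of a v z u w]
  by (simp add: kA_def A14_eq)

section \<open>The curvature of \<open>g\<^sub>A\<close> in terms of bivectors\<close>

lemma bA_simps:
  "bA a 1 1 p u v = 2 * (1 - a 1 1) * p $ Ix 3 * (u $ Ix 1 * v $ Ix 3 + u $ Ix 3 * v $ Ix 1)
     - 2 * a 1 1 * p $ Ix 1 * u $ Ix 3 * v $ Ix 3"
  "bA a 1 2 p u v = 2 * (1 - a 1 2) * p $ Ix 2 * (u $ Ix 1 * v $ Ix 2 + u $ Ix 2 * v $ Ix 1)
     - 2 * a 1 2 * p $ Ix 1 * u $ Ix 2 * v $ Ix 2"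
  "bA a 2 1 p u v = 2 * (1 - a 2 1) * p $ Ix 1 * (u $ Ix 1 * v $ Ix 2 + u $ Ix 2 * v $ Ix 1)
     - 2 * a 2 1 * p $ Ix 2 * u $ Ix 1 * v $ Ix 1"
  "bA a 2 2 p u v = 2 * (1 - a 2 2) * p $ Ix 3 * (u $ Ix 2 * v $ Ix 3 + u $ Ix 3 * v $ Ix 2)
     - 2 * a 2 2 * p $ Ix 2 * u $ Ix 3 * v $ Ix 3"
  "bA a 3 1 p u v = 2 * (1 - a 3 1) * p $ Ix 1 * (u $ Ix 1 * v $ Ix 3 + u $ Ix 3 * v $ Ix 1)
     - 2 * a 3 1 * p $ Ix 3 * u $ Ix 1 * v $ Ix 1"
  "bA a 3 2 p u v = 2 * (1 - a 3 2) * p $ Ix 2 * (u $ Ix 2 * v $ Ix 3 + u $ Ix 3 * v $ Ix 2)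
     - 2 * a 3 2 * p $ Ix 3 * u $ Ix 2 * v $ Ix 2"
  "bA a 4 1 p u v = p $ Ix 1 * (u $ Ix 2 * v $ Ix 3 + u $ Ix 3 * v $ Ix 2)"
  "bA a 4 2 p u v = p $ Ix 2 * (u $ Ix 1 * v $ Ix 3 + u $ Ix 3 * v $ Ix 1)"
  by (simp_all add: bA_def hA_def Let_def axis_nth)

lemma \<Gamma>A_y:
  "\<Gamma>A a p u v $ Iy 1 1 = - bA a 1 2 p u v / 2" "\<Gamma>A a p u v $ Iy 1 2 = - bA a 1 1 p u v / 2"
  "\<Gamma>A a p u v $ Iy 2 1 = - bA a 2 2 p u v / 2" "\<Gamma>A a p u v $ Iy 2 2 = - bA a 2 1 p u v / 2"
  "\<Gamma>A a p u v $ Iy 3 1 = - bA a 3 2 p u v / 2" "\<Gamma>A a p u v $ Iy 3 2 = - bA a 3 1 p u v / 2"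
  "\<Gamma>A a p u v $ Iy 4 1 = 4/3 * bA a 4 1 p u v + 2/3 * bA a 4 2 p u v"
  "\<Gamma>A a p u v $ Iy 4 2 = 4/3 * bA a 4 2 p u v + 2/3 * bA a 4 1 p u v"
  by (simp_all add: \<Gamma>A_def)

lemma hA_bA: "hA a p w u v =
      w $ Iy 1 1 * bA a 1 1 p u v + w $ Iy 1 2 * bA a 1 2 p u v +
      w $ Iy 2 1 * bA a 2 1 p u v + w $ Iy 2 2 * bA a 2 2 p u v +
      w $ Iy 3 1 * bA a 3 1 p u v + w $ Iy 3 2 * bA a 3 2 p u v +
      w $ Iy 4 1 * bA a 4 1 p u v + w $ Iy 4 2 * bA a 4 2 p u v"
  by (simp add: bA_def hA_def Let_def axis_nth algebra_simps)

text \<open>Two base points are kept apart because differentiating the curvature replaces one of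
  them by the direction.\<close>

definition QA :: "(3 \<Rightarrow> 2 \<Rightarrow> real) \<Rightarrow> real^idx14 \<Rightarrow> real^idx14 \<Rightarrow> real^idx14 \<Rightarrow> real^idx14 \<Rightarrow> real^idx14 \<Rightarrow>
    real^idx14 \<Rightarrow> real" where
  "QA a p u z t v w = ip14 (\<Gamma>A a p u (\<Gamma>A a t v w)) z"

text \<open>The inner \<open>\<Gamma>A\<close> has no x-component, so of the six terms of
  \<open>kA\<close> only the derivative of the metric along it survives. The coefficients are -1/4
  times the inverse of the constant y-block.\<close>

lemma QA_eq: "QA a p u z t v w =
   - (bA a 1 1 p u z * bA a 1 2 t v w + bA a 1 2 p u z * bA a 1 1 t v w) / 4
   - (bA a 2 1 p u z * bA a 2 2 t v w + bA a 2 2 p u z * bA a 2 1 t v w) / 4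
   - (bA a 3 1 p u z * bA a 3 2 t v w + bA a 3 2 p u z * bA a 3 1 t v w) / 4
   + 2/3 * (bA a 4 1 p u z * bA a 4 1 t v w + bA a 4 2 p u z * bA a 4 2 t v w)
   + 1/3 * (bA a 4 1 p u z * bA a 4 2 t v w + bA a 4 2 p u z * bA a 4 1 t v w)"
proof -
  have zero: "hA a (\<Gamma>A a t v w) p u z = 0" "hA a p q (\<Gamma>A a t v w) z = 0" "hA a q p (\<Gamma>A a t v w) z = 0"
    "hA a p q u (\<Gamma>A a t v w) = 0" "hA a q p u (\<Gamma>A a t v w) = 0" for p q u z
    by (simp_all add: hA_def Let_def \<Gamma>A_x)
  have "QA a p u z t v w = hA a p (\<Gamma>A a t v w) u z / 2"
    by (simp add: QA_def ip14_\<Gamma>A kA_def zero)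
  also note hA_bA
  finally show ?thesis
    by (simp add: \<Gamma>A_y algebra_simps add_divide_distrib diff_divide_distrib)
qed

text \<open>Polarized matrix, on bivectors, of the part of the curvature that is quadratic in the
  base point.\<close>

definition nA :: "(3 \<Rightarrow> 2 \<Rightarrow> real) \<Rightarrow> real^idx14 \<Rightarrow> real^idx14 \<Rightarrow> real^3^3" where
  "nA a p t =
    (let \<mu> = (\<lambda>i. a i 1 * a i 2); s = (\<lambda>i j. (p $ Ix i * t $ Ix j + p $ Ix j * t $ Ix i) / 2);
       n11 = (\<mu> 1 + 2/3) * s 1 1; n22 = (\<mu> 2 + 2/3) * s 2 2; n33 = \<mu> 3 * s 3 3;
       n12 = (a 1 1 + a 2 2 - a 3 1 - a 3 2 - \<mu> 1 - \<mu> 2 + \<mu> 3 + 2/3) * s 1 2;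
       n13 = (a 1 2 - a 2 1 - a 2 2 + a 3 2 - \<mu> 1 + \<mu> 2 - \<mu> 3 + 1) * s 1 3;
       n23 = (a 2 1 - a 1 1 - a 1 2 + a 3 1 + \<mu> 1 - \<mu> 2 - \<mu> 3 + 1) * s 2 3
     in vector [vector [n11, n12, n13], vector [n12, n22, n23], vector [n13, n23, n33]])"

lemma form_3: "form (M :: real^3^3) U W =
   U $ 1 * (M $ 1 $ 1 * W $ 1 + M $ 1 $ 2 * W $ 2 + M $ 1 $ 3 * W $ 3) +
   U $ 2 * (M $ 2 $ 1 * W $ 1 + M $ 2 $ 2 * W $ 2 + M $ 2 $ 3 * W $ 3) +
   U $ 3 * (M $ 3 $ 1 * W $ 1 + M $ 3 $ 2 * W $ 2 + M $ 3 $ 3 * W $ 3)"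
  by (simp add: form_sum sum_3 algebra_simps)

text \<open>Up to a factor the left sides are Kulkarni-Nomizu products of symmetric forms in the
  x-parts, hence symmetric forms on bivectors.\<close>

lemma bA_antisymmetric:
  fixes p u v w z :: "real^idx14" and a :: "3 \<Rightarrow> 2 \<Rightarrow> real"
  defines "s \<equiv> \<lambda>i j. p $ Ix i * p $ Ix j *
      (wedge u v $ i * wedge w z $ j + wedge u v $ j * wedge w z $ i) / 2"
  shows "bA a 1 1 p u z * bA a 1 2 p v w + bA a 1 2 p u z * bA a 1 1 p v w
      - bA a 1 1 p v z * bA a 1 2 p u w - bA a 1 2 p v z * bA a 1 1 p u w =
      - 4 * (a 1 1 * a 1 2 * s 1 1 + 2 * a 1 1 * (1 - a 1 2) * s 1 2 + 2 * (1 - a 1 1) * a 1 2 * s 1 3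
        + 2 * (1 - a 1 1) * (1 - a 1 2) * s 2 3)"
    and "bA a 2 1 p u z * bA a 2 2 p v w + bA a 2 2 p u z * bA a 2 1 p v w
      - bA a 2 1 p v z * bA a 2 2 p u w - bA a 2 2 p v z * bA a 2 1 p u w =
      - 4 * (a 2 1 * a 2 2 * s 2 2 + 2 * (1 - a 2 1) * a 2 2 * s 1 2 + 2 * a 2 1 * (1 - a 2 2) * s 2 3
        + 2 * (1 - a 2 1) * (1 - a 2 2) * s 1 3)"
    and "bA a 3 1 p u z * bA a 3 2 p v w + bA a 3 2 p u z * bA a 3 1 p v w
      - bA a 3 1 p v z * bA a 3 2 p u w - bA a 3 2 p v z * bA a 3 1 p u w =
      - 4 * (a 3 1 * a 3 2 * s 3 3 + 2 * (1 - a 3 1) * a 3 2 * s 1 3 + 2 * a 3 1 * (1 - a 3 2) * s 2 3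
        + 2 * (1 - a 3 1) * (1 - a 3 2) * s 1 2)"
    and "bA a 4 1 p u z * bA a 4 1 p v w - bA a 4 1 p v z * bA a 4 1 p u w = s 1 1"
    and "bA a 4 2 p u z * bA a 4 2 p v w - bA a 4 2 p v z * bA a 4 2 p u w = s 2 2"
    and "bA a 4 1 p u z * bA a 4 2 p v w + bA a 4 2 p u z * bA a 4 1 p v w
      - bA a 4 1 p v z * bA a 4 2 p u w - bA a 4 2 p v z * bA a 4 1 p u w = - 2 * s 1 2"
  unfolding bA_simps s_def wedge_nth by algebra+

lemma QA_antisymmetric:
  "QA a p u z p v w - QA a p v z p u w = form (nA a p p) (wedge u v) (wedge w z)"
proof -
  have "QA a p u z p v w - QA a p v z p u w =
      - (bA a 1 1 p u z * bA a 1 2 p v w + bA a 1 2 p u z * bA a 1 1 p v w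
        - bA a 1 1 p v z * bA a 1 2 p u w - bA a 1 2 p v z * bA a 1 1 p u w) / 4
      - (bA a 2 1 p u z * bA a 2 2 p v w + bA a 2 2 p u z * bA a 2 1 p v w
        - bA a 2 1 p v z * bA a 2 2 p u w - bA a 2 2 p v z * bA a 2 1 p u w) / 4
      - (bA a 3 1 p u z * bA a 3 2 p v w + bA a 3 2 p u z * bA a 3 1 p v w
        - bA a 3 1 p v z * bA a 3 2 p u w - bA a 3 2 p v z * bA a 3 1 p u w) / 4
      + 2/3 * (bA a 4 1 p u z * bA a 4 1 p v w - bA a 4 1 p v z * bA a 4 1 p u w)
      + 2/3 * (bA a 4 2 p u z * bA a 4 2 p v w - bA a 4 2 p v z * bA a 4 2 p u w)
      + 1/3 * (bA a 4 1 p u z * bA a 4 2 p v w + bA a 4 2 p u z * bA a 4 1 p v w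
        - bA a 4 1 p v z * bA a 4 2 p u w - bA a 4 2 p v z * bA a 4 1 p u w)"
    by (simp add: QA_eq field_simps)
  then show ?thesis
    unfolding bA_antisymmetric form_3 nA_def Let_def vector_3 by algebra
qed

lemma RA_eq:
  "RA a p u v w z = A14 u v w z + form (nA a p p) (wedge u v) (wedge w z)"
proof -
  have "RA a p u v w z = (kA a u v w z - kA a v u w z) / 2 + (QA a p u z p v w - QA a p v z p u w)"
    by (simp add: RA_def QA_def ip14_linear ip14_\<Gamma>A)
  then show ?thesis
    by (simp add: QA_antisymmetric kA_antisymmetric)
qed

section \<open>Covariant derivative of the curvature on bivectors\<close>

lemma QA_linear:
  "QA a (p + p') u z t v w = QA a p u z t v w + QA a p' u z t v w"
  "QA a p u z (t + t') v w = QA a p u z t v w + QA a p u z t' v w"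
  by (simp_all add: QA_def \<Gamma>A_linear ip14_linear)

text \<open>Polarization: evaluate \<open>QA_antisymmetric\<close> at \<open>p + t\<close> and
  subtract its values at \<open>p\<close> and \<open>t\<close>.\<close>

lemma QA_antisymmetric_polarized:
  "QA a t u z p v w + QA a p u z t v w - QA a t v z p u w - QA a p v z t u w =
    2 * form (nA a p t) (wedge u v) (wedge w z)"
proof -
  have "QA a t u z p v w + QA a p u z t v w - QA a t v z p u w - QA a p v z t u w =
    form (nA a (p + t) (p + t)) (wedge u v) (wedge w z)
    - form (nA a p p) (wedge u v) (wedge w z) - form (nA a t t) (wedge u v) (wedge w z)"
    by (simp add: QA_antisymmetric[symmetric] QA_linear)
  then show ?thesis
    unfolding form_3 nA_def Let_def vector_3 vector_add_component by algebra
qed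

text \<open>The Christoffel correction as a bilinear form: rows belong to the untouched bivector,
  columns to the one whose vectors are differentiated. It need not be symmetric.\<close>

definition sA :: "(3 \<Rightarrow> 2 \<Rightarrow> real) \<Rightarrow> real^idx14 \<Rightarrow> real^idx14 \<Rightarrow> real^3^3" where
  "sA a p t = (let x = (\<lambda>i. p $ Ix i); y = (\<lambda>i. t $ Ix i) in vector
    [vector [(a 2 1 + a 3 1 - 2) * x 1 * y 1,
             (2/3 - a 2 1) * x 1 * y 2 - (2/3 + a 2 1) * x 2 * y 1,
             (4/3 - a 3 1) * x 1 * y 3 - a 3 1 * x 3 * y 1],
     vector [(2/3 - a 1 2) * x 2 * y 1 - (2/3 + a 1 2) * x 1 * y 2,
             (a 1 2 + a 3 2 - 2) * x 2 * y 2,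
             (4/3 - a 3 2) * x 2 * y 3 - a 3 2 * x 3 * y 2],
     vector [(1 - a 1 1) * x 3 * y 1 - (1/3 + a 1 1) * x 1 * y 3,
             (1 - a 2 2) * x 3 * y 2 - (1/3 + a 2 2) * x 2 * y 3,
             (a 1 1 + a 2 2 - 2) * x 3 * y 3]])"

lemma \<phi>_\<Gamma>A_antisymmetric:
  "\<phi> W v (\<Gamma>A a p t u) - \<phi> W u (\<Gamma>A a p t v) = form (sA a p t) W (wedge u v)"
  unfolding form_3 sA_def Let_def vector_3 \<phi>_def \<Gamma>A_y bA_simps wedge_nth by algebra

lemma wedge_\<Gamma>A: "wedge (\<Gamma>A a p t u) v = 0" "wedge u (\<Gamma>A a p t v) = 0"
  by (simp_all add: vec_eq_iff forall_3 wedge_nth \<Gamma>A_x)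

lemma \<phi>_zero: "\<phi> 0 w z = 0" "\<phi> U (\<Gamma>A a p t u) z = 0"
  by (simp_all add: \<phi>_def \<Gamma>A_x)

text \<open>A value of \<open>\<Gamma>A\<close> annihilates the bivector containing it, and with it
  the quadratic part and all terms of \<open>A14_eq\<close> but one.\<close>

lemma RA_\<Gamma>A:
  "RA a p (\<Gamma>A a p' t u) v w z = - \<phi> (wedge w z) v (\<Gamma>A a p' t u)"
  "RA a p u (\<Gamma>A a p' t v) w z = \<phi> (wedge w z) u (\<Gamma>A a p' t v)"
  "RA a p u v (\<Gamma>A a p' t w) z = - \<phi> (wedge u v) z (\<Gamma>A a p' t w)"
  "RA a p u v w (\<Gamma>A a p' t z) = \<phi> (wedge u v) w (\<Gamma>A a p' t z)"
  by (simp_all add: RA_eq A14_eq wedge_\<Gamma>A \<phi>_zero form_3)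

text \<open>The entries of \<open>\<kappa>\<close> measure the failure of the three conditions. The
  off-diagonal coefficients are combinations of the diagonal ones, so three conditions govern all
  six.\<close>

lemma DRA_eq:
  fixes p t u v w z :: "real^idx14" and a :: "3 \<Rightarrow> 2 \<Rightarrow> real"
  defines "\<kappa> \<equiv> vector
      [a 2 1 + a 3 1 + a 1 1 * a 1 2 - 4/3, a 1 2 + a 3 2 + a 2 1 * a 2 2 - 4/3,
       a 1 1 + a 2 2 + a 3 1 * a 3 2 - 2] :: real^3"
    and "s \<equiv> \<lambda>i j. (p $ Ix i * t $ Ix j + p $ Ix j * t $ Ix i) *
      (wedge u v $ i * wedge w z $ j + wedge u v $ j * wedge w z $ i)"
  shows "2 * DRA a p t u v w z =
    \<kappa> $ 1 * s 1 1 + \<kappa> $ 2 * s 2 2 + \<kappa> $ 3 * s 3 3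
    + 2 * (\<kappa> $ 3 - \<kappa> $ 1 - \<kappa> $ 2) * s 1 2 + 2 * (\<kappa> $ 2 - \<kappa> $ 1 - \<kappa> $ 3) * s 1 3
    + 2 * (\<kappa> $ 1 - \<kappa> $ 2 - \<kappa> $ 3) * s 2 3"
proof -
  \<comment> \<open>The first group is twice the polarized \<open>nA\<close>; the other two are
    \<open>sA\<close> with the bivectors in either order, which symmetrizes it.\<close>
  have "DRA a p t u v w z =
     (QA a t u z p v w + QA a p u z t v w - QA a t v z p u w - QA a p v z t u w)
     + (\<phi> (wedge w z) v (\<Gamma>A a p t u) - \<phi> (wedge w z) u (\<Gamma>A a p t v))
     + (\<phi> (wedge u v) z (\<Gamma>A a p t w) - \<phi> (wedge u v) w (\<Gamma>A a p t z))"
    by (simp add: DRA_def QA_def ip14_linear RA_\<Gamma>A)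
  then show ?thesis
    unfolding QA_antisymmetric_polarized \<phi>_\<Gamma>A_antisymmetric
      form_3 nA_def sA_def \<kappa>_def s_def Let_def vector_3 by algebra
qed

lemma locally_symmetric_gA_iff:
  "locally_symmetric (gA a) \<longleftrightarrow>
     a 1 1 + a 2 2 + a 3 1 * a 3 2 = 2 \<and>
     3 * a 2 1 + 3 * a 3 1 + 3 * a 1 2 * a 1 1 = 4 \<and>
     3 * a 1 2 + 3 * a 3 2 + 3 * a 2 1 * a 2 2 = 4"
proof -
  \<comment> \<open>With \<open>p\<close> and \<open>t\<close> both the i-th x-vector and both
    bivectors spanned by the other two, only \<open>s i i = 4\<close> is non-zero.\<close>
  have DRA_axis: "DRA a (axis (Ix 1) 1) (axis (Ix 1) 1)
        (axis (Ix 2) 1) (axis (Ix 3) 1) (axis (Ix 2) 1) (axis (Ix 3) 1) =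
      2 * (a 2 1 + a 3 1 + a 1 1 * a 1 2 - 4/3)"
    "DRA a (axis (Ix 2) 1) (axis (Ix 2) 1)
        (axis (Ix 3) 1) (axis (Ix 1) 1) (axis (Ix 3) 1) (axis (Ix 1) 1) =
      2 * (a 1 2 + a 3 2 + a 2 1 * a 2 2 - 4/3)"
    "DRA a (axis (Ix 3) 1) (axis (Ix 3) 1)
        (axis (Ix 1) 1) (axis (Ix 2) 1) (axis (Ix 1) 1) (axis (Ix 2) 1) =
      2 * (a 1 1 + a 2 2 + a 3 1 * a 3 2 - 2)"
    using DRA_eq[of a "axis (Ix 1) 1" "axis (Ix 1) 1"
        "axis (Ix 2) 1" "axis (Ix 3) 1" "axis (Ix 2) 1" "axis (Ix 3) 1"]
      DRA_eq[of a "axis (Ix 2) 1" "axis (Ix 2) 1"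
        "axis (Ix 3) 1" "axis (Ix 1) 1" "axis (Ix 3) 1" "axis (Ix 1) 1"]
      DRA_eq[of a "axis (Ix 3) 1" "axis (Ix 3) 1"
        "axis (Ix 1) 1" "axis (Ix 2) 1" "axis (Ix 1) 1" "axis (Ix 2) 1"]
    by (simp_all add: wedge_nth axis_nth vector_3)
  show ?thesis
  proof
    assume "locally_symmetric (gA a)"
    with DRA_axis show "a 1 1 + a 2 2 + a 3 1 * a 3 2 = 2 \<and>
       3 * a 2 1 + 3 * a 3 1 + 3 * a 1 2 * a 1 1 = 4 \<and>
       3 * a 1 2 + 3 * a 3 2 + 3 * a 2 1 * a 2 2 = 4"
      unfolding locally_symmetric_gA by (simp add: algebra_simps)
  next
    assume "a 1 1 + a 2 2 + a 3 1 * a 3 2 = 2 \<and>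
       3 * a 2 1 + 3 * a 3 1 + 3 * a 1 2 * a 1 1 = 4 \<and>
       3 * a 1 2 + 3 * a 3 2 + 3 * a 2 1 * a 2 2 = 4"
    then have 0: "a 2 1 + a 3 1 + a 1 1 * a 1 2 - 4/3 = 0" "a 1 2 + a 3 2 + a 2 1 * a 2 2 - 4/3 = 0"
      "a 1 1 + a 2 2 + a 3 1 * a 3 2 - 2 = 0"
      by (simp_all add: algebra_simps)
    have "2 * DRA a p t u v w z = 0" for p t u v w z
      unfolding DRA_eq vector_3 0 by simp
    then show "locally_symmetric (gA a)"
      by (simp add: locally_symmetric_gA)
  qed
qed

section \<open>The model isometry\<close>

text \<open>Adding \<open>LA n u\<close> to \<open>u\<close> changes the model tensor by the symmetric form \<open>n\<close> on bivectors.\<close>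

definition LA :: "real^3^3 \<Rightarrow> real^idx14 \<Rightarrow> real^idx14" where
  "LA n u = axis (Iy 2 1) (- n $ 3 $ 3 / 2 * u $ Ix 2) + axis (Iy 3 1) (- n $ 2 $ 2 / 2 * u $ Ix 3)
     + axis (Iy 3 2) (- n $ 1 $ 1 / 2 * u $ Ix 3)
     + axis (Iy 4 1) (2 * n $ 1 $ 2 * u $ Ix 3 - n $ 2 $ 3 * u $ Ix 1)
     + axis (Iy 4 2) (- n $ 1 $ 3 * u $ Ix 2)"

lemma LA_y:
  "LA n u $ Iy 1 j = 0"
  "LA n u $ Iy 2 1 = - n $ 3 $ 3 / 2 * u $ Ix 2" "LA n u $ Iy 2 2 = 0"
  "LA n u $ Iy 3 1 = - n $ 2 $ 2 / 2 * u $ Ix 3" "LA n u $ Iy 3 2 = - n $ 1 $ 1 / 2 * u $ Ix 3"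
  "LA n u $ Iy 4 1 = 2 * n $ 1 $ 2 * u $ Ix 3 - n $ 2 $ 3 * u $ Ix 1"
  "LA n u $ Iy 4 2 = - n $ 1 $ 3 * u $ Ix 2"
  by (simp_all add: LA_def axis_nth)

lemma LA_antisymmetric:
  assumes n: "transpose n = n" and UW: "U = wedge u v" "W = wedge w z"
  shows "\<phi> U w (LA n z) - \<phi> U z (LA n w) + \<phi> W u (LA n v) - \<phi> W v (LA n u) = form n U W"
proof -
  have n_sym: "n $ i $ j = n $ j $ i" for i j
    by (subst n[symmetric]) (simp add: transpose_def)
  \<comment> \<open>The form is not symmetric: \<open>n $ 1 $ 2\<close> occurs with full weight, but
    only at \<open>U $ 2 * W $ 1\<close>. Adding the form with \<open>U\<close> and \<open>W\<close>
    exchanged restores \<open>n\<close>.\<close>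
  have half: "\<phi> U w (LA n z) - \<phi> U z (LA n w) =
      U $ 1 * (n $ 1 $ 1 * W $ 1 + n $ 1 $ 3 * W $ 3) / 2
      + U $ 2 * (2 * n $ 1 $ 2 * W $ 1 + n $ 2 $ 2 * W $ 2 + n $ 2 $ 3 * W $ 3) / 2
      + U $ 3 * (n $ 1 $ 3 * W $ 1 + n $ 2 $ 3 * W $ 2 + n $ 3 $ 3 * W $ 3) / 2"
    if "W = wedge w z" for U W w z
    unfolding that \<phi>_def LA_y wedge_nth by (simp add: field_simps)
  show ?thesis
    using half[OF UW(2), of U] half[OF UW(1), of W]
    by (simp add: form_3 n_sym[of 2 1] n_sym[of 3 1] n_sym[of 3 2] field_simps)
qed

text \<open>Pairing with x-parts counts each \<open>Ixs\<close>-correction once for \<open>u\<close>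
  and once for \<open>v\<close>: the symmetric terms are therefore halved, while
  \<open>ip14 u (L v)\<close> and \<open>ip14 v (L u)\<close> supply each other.\<close>

definition \<Theta>A :: "(3 \<Rightarrow> 2 \<Rightarrow> real) \<Rightarrow> real^idx14 \<Rightarrow> real^idx14 \<Rightarrow> real^idx14" where
  "\<Theta>A a p u = (let L = LA (nA a p p) in
     u + L u + (\<Sum>i\<in>UNIV. axis (Ixs i)
       ((hA a p p u (axis (Ix i) 1) - ip14 (L u) (L (axis (Ix i) 1))) / 2 - ip14 u (L (axis (Ix i) 1)))))"

lemma \<Theta>A_x: "\<Theta>A a p u $ Ix i = u $ Ix i"
  by (simp add: \<Theta>A_def LA_def axis_nth)

lemma \<Theta>A_xs: "\<Theta>A a p u $ Ixs i = u $ Ixs i +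
   (hA a p p u (axis (Ix i) 1) - ip14 (LA (nA a p p) u) (LA (nA a p p) (axis (Ix i) 1))) / 2
   - ip14 u (LA (nA a p p) (axis (Ix i) 1))"
  by (simp add: \<Theta>A_def LA_def axis_nth Let_def)

lemma \<Theta>A_y: "\<Theta>A a p u $ Iy k j = u $ Iy k j + LA (nA a p p) u $ Iy k j"
  by (simp add: \<Theta>A_def axis_nth Let_def)

lemma LA_linear:
  "LA n (u + v) = LA n u + LA n v" "LA n (r *\<^sub>R u) = r *\<^sub>R LA n u"
  by (simp_all add: LA_def vec_eq_iff axis_nth algebra_simps add_divide_distrib)

lemma linear_\<Theta>A: "linear (\<Theta>A a p)"
proof -
  have "\<Theta>A a p (u + v) $ c = (\<Theta>A a p u + \<Theta>A a p v) $ c \<and> \<Theta>A a p (r *\<^sub>R u) $ c = (r *\<^sub>R \<Theta>A a p u) $ c"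
    for u v r c
    by (cases c) (simp_all add: \<Theta>A_x \<Theta>A_xs \<Theta>A_y LA_linear hA_linear ip14_linear algebra_simps
       add_divide_distrib diff_divide_distrib)
  then show ?thesis
    by (simp add: linear_iff vec_eq_iff)
qed

lemma ip14_\<Theta>A: "ip14 (\<Theta>A a p u) (\<Theta>A a p v) = form (gA a p) u v"
proof -
  define L where "L = LA (nA a p p)"
  define e where "e i = (axis (Ix i) 1 :: real^idx14)" for i
  have L: "L u $ Ix i = 0" "L u $ Ixs i = 0" for u i
    by (simp_all add: L_def LA_def axis_nth)
  \<comment> \<open>\<open>L\<close> and \<open>hA\<close> see only x-parts, so summing the
    corrections against x-coordinates rebuilds the full bilinear forms.\<close>
  have Le: "L u = u $ Ix 1 *\<^sub>R L (e 1) + u $ Ix 2 *\<^sub>R L (e 2) + u $ Ix 3 *\<^sub>R L (e 3)" for u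
    by (simp add: L_def LA_def e_def vec_eq_iff axis_nth algebra_simps)
  have he: "hA a p p u v = u $ Ix 1 * hA a p p v (e 1) + u $ Ix 2 * hA a p p v (e 2) + u $ Ix 3 * hA a p p v (e 3)"
    for u v
    by (simp add: hA_def e_def Let_def axis_nth algebra_simps)
  have "ip14 (\<Theta>A a p u) (\<Theta>A a p v) = ip14 (u + L u) (v + L v) +
     (\<Sum>i\<in>UNIV. u $ Ix i * (\<Theta>A a p v $ Ixs i - v $ Ixs i) + v $ Ix i * (\<Theta>A a p u $ Ixs i - u $ Ixs i))"
    by (simp add: ip14_eq sum_3 L \<Theta>A_x \<Theta>A_y L_def[symmetric] algebra_simps)
  also have "(\<Sum>i\<in>UNIV. u $ Ix i * (\<Theta>A a p v $ Ixs i - v $ Ixs i) + v $ Ix i * (\<Theta>A a p u $ Ixs i - u $ Ixs i)) =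
     (hA a p p u v + hA a p p v u) / 2 - (ip14 (L u) (L v) + ip14 (L v) (L u)) / 2
     - ip14 u (L v) - ip14 v (L u)"
  proof -
    have "(\<Sum>i\<in>UNIV. u $ Ix i * (\<Theta>A a p v $ Ixs i - v $ Ixs i)) =
        hA a p p u v / 2 - ip14 (L v) (L u) / 2 - ip14 v (L u)" for u v
      unfolding he[of u v] Le[of u]
      by (simp add: sum_3 \<Theta>A_xs L_def[symmetric] e_def[symmetric] ip14_linear
          algebra_simps add_divide_distrib diff_divide_distrib)
    then show ?thesis
      by (simp add: sum.distrib add_divide_distrib)
  qed
  also have "hA a p p v u = hA a p p u v"
    by (rule hA_commute)
  finally show ?thesis
    by (simp add: form_gA ip14_linear ip14_commute[of "L v"] ip14_commute[of v "L u"])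
qed

text \<open>Bivectors are unchanged and \<open>\<phi>\<close> ignores \<open>Ixs\<close>-components,
  so only \<open>LA\<close> matters; by \<open>LA_antisymmetric\<close> it contributes exactly
  \<open>nA\<close>.\<close>

lemma A14_\<Theta>A: "A14 (\<Theta>A a p u) (\<Theta>A a p v) (\<Theta>A a p w) (\<Theta>A a p z) = RA a p u v w z"
proof -
  have wedge: "wedge (\<Theta>A a p u) (\<Theta>A a p v) = wedge u v" for u v
    by (simp add: wedge_def \<Theta>A_x)
  have \<phi>: "\<phi> U (\<Theta>A a p w) (\<Theta>A a p z) = \<phi> U w z + \<phi> U w (LA (nA a p p) z)" for U w z
    by (simp add: \<phi>_def \<Theta>A_x \<Theta>A_y algebra_simps add_divide_distrib diff_divide_distrib)
  have "transpose (nA a p p) = nA a p p"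
    by (simp add: transpose_def vec_eq_iff forall_3 nA_def Let_def vector_3)
  from LA_antisymmetric[OF this refl refl, of u v w z] show ?thesis
    by (simp add: RA_eq A14_eq wedge \<phi>)
qed

lemma has_0_model_gA: "has_0_model (gA a) ip14 A14"
  unfolding has_0_model_def
proof (intro allI exI conjI impI)
  fix p
  show "linear (\<Theta>A a p)"
    by (rule linear_\<Theta>A)
  \<comment> \<open>By the isometry property a kernel vector is orthogonal to every vector.\<close>
  have "u = 0" if "\<Theta>A a p u = 0" for u
  proof (rule gA_nondegenerate)
    show "form (gA a p) u v = 0" for v
      unfolding ip14_\<Theta>A[symmetric] that by (simp add: ip14_eq)
  qed
  then have "inj (\<Theta>A a p)"
    by (simp add: linear_injective_0[OF linear_\<Theta>A])
  then show "bij (\<Theta>A a p)"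
    using linear_injective_imp_surjective[OF linear_\<Theta>A] by (simp add: bij_def)
  show "ip14 (\<Theta>A a p u) (\<Theta>A a p v) = form (gA a p) u v" for u v
    by (rule ip14_\<Theta>A)
  show "A14 (\<Theta>A a p (X p)) (\<Theta>A a p (Y p)) (\<Theta>A a p (Z p)) (\<Theta>A a p (W p)) = curv (gA a) X Y Z W p"
    if "smooth X \<and> smooth Y \<and> smooth Z \<and> smooth W" for X Y Z W
    using that by (simp add: curv_gA A14_\<Theta>A)
qed

theorem theorem1p9:
  fixes a :: "3 \<Rightarrow> 2 \<Rightarrow> real"
  shows "has_0_model (gA a) ip14 A14 \<and>
    (locally_symmetric (gA a) \<longleftrightarrow>
       a 1 1 + a 2 2 + a 3 1 * a 3 2 = 2 \<and>
       3 * a 2 1 + 3 * a 3 1 + 3 * a 1 2 * a 1 1 = 4 \<and>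
       3 * a 1 2 + 3 * a 3 2 + 3 * a 2 1 * a 2 2 = 4)"
  using has_0_model_gA locally_symmetric_gA_iff by blast

end
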